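(* Let $L$ and $B$ be commuting matrix ordinary differential operators in $\mathcal{R}_\ell[D]$, with $L=A_0+A_1D$ and $A_1$ invertible, and let $f(\lambda,\mu)=\mathrm{DRes}(L-\lambda,B-\mu)\in C[\lambda,\mu]$. Let $(\lambda_0,\mu_0)\in C^2$. The spectral problem $$LY=\lambda_0Y,\qquad BY=\mu_0Y$$ has a nontrivial solution (with entries in some differential field extension of $K$) if and only if $f(\lambda_0,\mu_0)=0$, that is, $(\lambda_0,\mu_0)$ is a point of the spectral curve $\Gamma=\{(\lambda,\mu)\in C^2\mid f(\lambda,\mu)=0\}$. Moreover, in that case there is a nontrivial common solution $\psi$ belonging to $\Sigma_0^\ell$, where $\Sigma_0$ is a Picard-Vessiot extension of $K$ for the linear differential system $$DY=N_{\lambda_0}Y,\qquad N_{\lambda_0}=-A_1^{-1}(A_0-\lambda_0I_\ell).$$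
   Context: $K$ is a differential field with derivation $\partial$ (write $a'=\partial(a)$) whose field of constants $C$ is algebraically closed of characteristic zero. $\mathcal{R}_\ell=M_\ell(K)$, with entrywise derivation $D(A)=A'$. $\mathcal{R}_\ell[D]$ is the ring of matrix ordinary differential operators $\sum_j B_jD^j$, $B_j\in\mathcal{R}_\ell$, with commutation rule $DA=AD+A'$; operators act on column vectors with entries in differential extensions of $K$, $D$ acting entrywise. $\lambda,\mu$ are algebraic variables over $K$ with $\partial\lambda=\partial\mu=0$. For $L=A_0+A_1D$ with $A_1$ invertible and $B=\sum_{j=0}^nB_jD^j$, $n\ge1$, put $N_\lambda=-A_1^{-1}(A_0-\lambda I_\ell)$, $p_0(N_\lambda)=I_\ell$, $p_j(N_\lambda)=p_{j-1}(N_\lambda)N_\lambda+(p_{j-1}(N_\lambda))'$ for $j\ge1$, $M(L-\lambda,B-\mu)=B_0-\mu I_\ell+\sum_{j=1}^nB_jp_j(N_\lambda)$, and $\mathrm{DRes}(L-\lambda,B-\mu)=\det M(L-\lambda,B-\mu)$. When $L$ and $B$ commute this is a polynomial in $C[\lambda,\mu]$. *)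

theory Defs
  imports
    "HOL-Analysis.Determinants"
    "HOL-Computational_Algebra.Polynomial"
    "HOL-Algebra.Generated_Fields"
    "HOL-Algebra.Algebraic_Closure_Type"
begin

(* would make every use of the vector component syntax ambiguous *)
no_notation fps_nth (infixl "$" 75)

locale field_derivation =
  fixes d :: "'a::field \<Rightarrow> 'a"
  assumes d_add: "d (a + b) = d a + d b"
    and d_mult: "d (a * b) = d a * b + a * d b"

definition constants :: "('a::field \<Rightarrow> 'a) \<Rightarrow> 'a set"
  where "constants d = {c. d c = 0}"

definition constants_alg_closed :: "('a::field \<Rightarrow> 'a) \<Rightarrow> bool"
  where "constants_alg_closed d \<longleftrightarrow>
    (\<forall>p. range (coeff p) \<subseteq> constants d \<longrightarrow> degree p \<ge> 1 \<longrightarrow> (\<exists>c\<in>constants d. poly p c = 0))"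

text \<open>
  The base field is a type. An extension field is a ring record over an arbitrary type, so that
  statements can assert the existence of extensions. The base field is mapped into it by a
  differential embedding \<open>\<iota>\<close> (injective, being a ring homomorphism between fields).
\<close>

locale diff_field_extension =
  field_derivation d + field E for d :: "'a::field \<Rightarrow> 'a" and E :: "'b ring" (structure) +
  fixes \<delta> :: "'b \<Rightarrow> 'b" and \<iota> :: "'a \<Rightarrow> 'b"
  assumes \<delta>_closed: "x \<in> carrier E \<Longrightarrow> \<delta> x \<in> carrier E"
    and \<delta>_add: "x \<in> carrier E \<Longrightarrow> y \<in> carrier E \<Longrightarrow> \<delta> (x \<oplus> y) = \<delta> x \<oplus> \<delta> y"
    and \<delta>_mult: "x \<in> carrier E \<Longrightarrow> y \<in> carrier E \<Longrightarrow> \<delta> (x \<otimes> y) = (\<delta> x \<otimes> y) \<oplus> (x \<otimes> \<delta> y)"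
    and \<iota>_hom: "\<iota> \<in> ring_hom ring_of_type_algebra E"
    and \<delta>_\<iota>: "\<delta> (\<iota> a) = \<iota> (d a)"

text \<open>
  The operator \<open>\<Sum>j. B\<^sub>j D\<^sup>j\<close> is stored as the finitely supported sequence of its coefficients,
  using the type of polynomials with matrix coefficients. Only the additive structure of that
  type is used (the type class product of matrices is the entrywise one); the product of
  operators is \<open>odo_mult\<close>, which is determined by \<open>D A = A D + A'\<close>.
\<close>

type_synonym ('a, 'l) odo = "(('a, 'l) vec, 'l) vec poly"

text \<open>\<open>odo_D d Q\<close> is the product \<open>D Q = \<Sum>j. Q\<^sub>j' D\<^sup>j + \<Sum>j. Q\<^sub>j D\<^bsup>j+1\<^esup>\<close>.\<close>

definition odo_D :: "('a::field \<Rightarrow> 'a) \<Rightarrow> ('a, 'l::finite) odo \<Rightarrow> ('a, 'l) odo"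
  where "odo_D d Q = map_poly (map_matrix d) Q + pCons 0 Q"

definition odo_mult ::
    "('a::field \<Rightarrow> 'a) \<Rightarrow> ('a, 'l::finite) odo \<Rightarrow> ('a, 'l) odo \<Rightarrow> ('a, 'l) odo"
  where "odo_mult d P Q =
    (\<Sum>i\<le>degree P. map_poly (\<lambda>A. coeff P i ** A) ((odo_D d ^^ i) Q))"

definition odo_apply ::
    "'b ring \<Rightarrow> ('b \<Rightarrow> 'b) \<Rightarrow> ('a::field \<Rightarrow> 'b) \<Rightarrow> ('a, 'l::finite) odo \<Rightarrow> 'b ^ 'l \<Rightarrow> 'b ^ 'l"
  where "odo_apply E \<delta> \<iota> P Y =
    (\<chi> i. \<Oplus>\<^bsub>E\<^esub>j\<in>{..degree P}. \<Oplus>\<^bsub>E\<^esub>k\<in>UNIV. \<iota> (coeff P j $ i $ k) \<otimes>\<^bsub>E\<^esub> (\<delta> ^^ j) (Y $ k))"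

text \<open>
  \<open>K[\<lambda>,\<mu>]\<close> is \<open>'a poly poly\<close>, with \<open>\<lambda>\<close> the inner and \<open>\<mu>\<close> the outer variable; the derivation
  acts on coefficients, i.e. \<open>\<partial>\<lambda> = \<partial>\<mu> = 0\<close>.
\<close>

definition lam :: "'a::field poly poly" where "lam = [:[:0, 1:]:]"

definition mu :: "'a::field poly poly" where "mu = [:0, 1:]"

definition lift_mat :: "'a::field ^ 'l ^ 'l \<Rightarrow> 'a poly poly ^ 'l ^ 'l"
  where "lift_mat = map_matrix (\<lambda>a. [:[:a:]:])"

definition lift_deriv :: "('a::field \<Rightarrow> 'a) \<Rightarrow> 'a poly poly \<Rightarrow> 'a poly poly"
  where "lift_deriv d = map_poly (map_poly d)"

definition eval2 :: "'a::field poly poly \<Rightarrow> 'a \<Rightarrow> 'a \<Rightarrow> 'a"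
  where "eval2 f l m = poly (poly f [:m:]) l"

definition N_lam :: "('a::field, 'l::finite) odo \<Rightarrow> 'a poly poly ^ 'l ^ 'l"
  where "N_lam L = - (lift_mat (matrix_inv (coeff L 1)) ** (lift_mat (coeff L 0) - mat lam))"

definition N_at :: "('a::field, 'l::finite) odo \<Rightarrow> 'a \<Rightarrow> 'a ^ 'l ^ 'l"
  where "N_at L l = - (matrix_inv (coeff L 1) ** (coeff L 0 - mat l))"

primrec p_seq :: "('r::comm_ring_1 \<Rightarrow> 'r) \<Rightarrow> 'r ^ 'l::finite ^ 'l \<Rightarrow> nat \<Rightarrow> 'r ^ 'l ^ 'l"
  where
    "p_seq \<delta> N 0 = mat 1"
  | "p_seq \<delta> N (Suc j) = p_seq \<delta> N j ** N + map_matrix \<delta> (p_seq \<delta> N j)"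

definition M_mat ::
    "('a::field \<Rightarrow> 'a) \<Rightarrow> ('a, 'l::finite) odo \<Rightarrow> ('a, 'l) odo \<Rightarrow> 'a poly poly ^ 'l ^ 'l"
  where "M_mat d L B = lift_mat (coeff B 0) - mat mu +
    (\<Sum>j=1..degree B. lift_mat (coeff B j) ** p_seq (lift_deriv d) (N_lam L) j)"

definition DRes ::
    "('a::field \<Rightarrow> 'a) \<Rightarrow> ('a, 'l::finite) odo \<Rightarrow> ('a, 'l) odo \<Rightarrow> 'a poly poly"
  where "DRes d L B = det (M_mat d L B)"

definition spectral_curve ::
    "('a::field \<Rightarrow> 'a) \<Rightarrow> ('a, 'l::finite) odo \<Rightarrow> ('a, 'l) odo \<Rightarrow> ('a \<times> 'a) set"
  where "spectral_curve d L B =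
    {(l, m). l \<in> constants d \<and> m \<in> constants d \<and> eval2 (DRes d L B) l m = 0}"

definition nontrivial_common_solution ::
    "'b ring \<Rightarrow> ('b \<Rightarrow> 'b) \<Rightarrow> ('a::field \<Rightarrow> 'b) \<Rightarrow> ('a, 'l::finite) odo \<Rightarrow> ('a, 'l) odo
      \<Rightarrow> 'a \<Rightarrow> 'a \<Rightarrow> 'b ^ 'l \<Rightarrow> bool"
  where "nontrivial_common_solution E \<delta> \<iota> L B l m Y \<longleftrightarrow>
    (\<forall>i. Y $ i \<in> carrier E) \<and> (\<exists>i. Y $ i \<noteq> \<zero>\<^bsub>E\<^esub>) \<and>
    odo_apply E \<delta> \<iota> L Y = (\<chi> i. \<iota> l \<otimes>\<^bsub>E\<^esub> Y $ i) \<and>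
    odo_apply E \<delta> \<iota> B Y = (\<chi> i. \<iota> m \<otimes>\<^bsub>E\<^esub> Y $ i)"

text \<open>
  \<open>F\<close> is a fundamental matrix of \<open>DY = N Y\<close>: it lies in \<open>GL\<^sub>l(E)\<close>, with inverse \<open>G\<close>, and
  \<open>F' = N F\<close>.
\<close>

definition fundamental_matrix ::
    "'b ring \<Rightarrow> ('b \<Rightarrow> 'b) \<Rightarrow> ('a::field \<Rightarrow> 'b) \<Rightarrow> 'a ^ 'l::finite ^ 'l \<Rightarrow> 'b ^ 'l ^ 'l \<Rightarrow> bool"
  where "fundamental_matrix E \<delta> \<iota> N F \<longleftrightarrow>
    (\<forall>i j. F $ i $ j \<in> carrier E) \<and>
    (\<exists>G :: 'b ^ 'l ^ 'l. (\<forall>i j. G $ i $ j \<in> carrier E) \<and>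
      (\<forall>i j. (\<Oplus>\<^bsub>E\<^esub>k\<in>UNIV. F $ i $ k \<otimes>\<^bsub>E\<^esub> G $ k $ j) = (if i = j then \<one>\<^bsub>E\<^esub> else \<zero>\<^bsub>E\<^esub>)) \<and>
      (\<forall>i j. (\<Oplus>\<^bsub>E\<^esub>k\<in>UNIV. G $ i $ k \<otimes>\<^bsub>E\<^esub> F $ k $ j) = (if i = j then \<one>\<^bsub>E\<^esub> else \<zero>\<^bsub>E\<^esub>))) \<and>
    (\<forall>i j. \<delta> (F $ i $ j) = (\<Oplus>\<^bsub>E\<^esub>k\<in>UNIV. \<iota> (N $ i $ k) \<otimes>\<^bsub>E\<^esub> F $ k $ j))"

text \<open>
  A Picard-Vessiot extension for \<open>DY = N Y\<close> has no new constants and is generated, as a field over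
  the base field, by the entries of a fundamental matrix.
\<close>

definition picard_vessiot ::
    "('a::field \<Rightarrow> 'a) \<Rightarrow> 'a ^ 'l::finite ^ 'l \<Rightarrow> 'b ring \<Rightarrow> ('b \<Rightarrow> 'b) \<Rightarrow> ('a \<Rightarrow> 'b) \<Rightarrow> bool"
  where "picard_vessiot d N E \<delta> \<iota> \<longleftrightarrow>
    diff_field_extension d E \<delta> \<iota> \<and>
    {x \<in> carrier E. \<delta> x = \<zero>\<^bsub>E\<^esub>} = \<iota> ` constants d \<and>
    (\<exists>F. fundamental_matrix E \<delta> \<iota> N F \<and>
      carrier E = generate_field E (range \<iota> \<union> {F $ i $ j | i j. True}))"

end

theory Submission
  imports Defs
begin

text \<open>
  Put \<open>N = N\<^sub>\<lambda>\<close>. Dividing \<open>B - \<mu>\<close> on the right by \<open>D - N\<close> leaves the remainder \<open>M\<close>, and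
  \<open>L B = B L\<close> becomes \<open>M' = N M - M N\<close>. Hence \<open>(det M)' = 0\<close>, so \<open>f\<close> has constant coefficients. At a
  point \<open>(\<lambda>\<^sub>0, \<mu>\<^sub>0)\<close> of \<open>C\<^sup>2\<close> the common solutions are the solutions of \<open>Y' = N Y\<close> with
  \<open>M Y = 0\<close>, which forces \<open>det M = 0\<close>. Conversely, \<open>M\<close> acts on the solution space of \<open>Y' = N Y\<close> in a
  Picard-Vessiot extension by a matrix over \<open>C\<close>, which is singular as soon as \<open>det M = 0\<close>.

  A Picard-Vessiot extension is found inside \<open>\<Omega>((t))\<close>, where \<open>\<Omega>\<close> is the algebraic closure of \<open>K\<close>
  and \<open>K\<close> is embedded by \<open>a \<mapsto> \<Sum>n. a\<^sup>(\<^sup>n\<^sup>) t\<^sup>n / n!\<close>. Among all fundamental matrices over \<open>\<Omega>[[t]]\<close>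
  choose one whose entries have least transcendence degree over \<open>K\<close>. A new constant \<open>c\<close> of the field
  they generate would be transcendental over \<open>K\<close>. A specialisation \<open>c \<mapsto> \<gamma> \<in> C\<close> extends to a ring
  homomorphism into \<open>\<Omega>\<close> that keeps the determinant nonzero, and its Taylor series is a differential
  homomorphism with nontrivial kernel. It maps the fundamental matrix to another one, of smaller
  transcendence degree, a contradiction.
\<close>

subsection \<open>Finitely generated subrings of integral domains\<close>

text \<open>Formal integration gives a fundamental matrix at once; the obstacle is to exclude new
  constants. Minimal transcendence degree replaces the usual quotient by a maximal differential
  ideal: the entries stay in the domain \<Omega>[[t]] throughout, and a missing algebraic relation
  is imposed by passing to another solution. The value \<gamma> is taken in C because the Taylor
  series of c and of \<gamma> then reduce to their constant terms, so that c - \<gamma> is sent to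
  0. C is infinite, which leaves room to avoid the finitely many \<gamma> that would spoil the
  determinant, and \<Omega> is algebraically closed, which supplies values for the algebraic
  generators. The rings involved are subrings of a domain rather than fields, so division is
  replaced by passing to a nonzero multiple that lies in the smaller ring. The equation M' = N M - M
  N makes det M constant because (1 + \<epsilon> N) M and M (1 + \<epsilon> N) have the same
  determinant, to first order in \<epsilon> as well.\<close>

definition is_subring :: "'r::comm_ring_1 set \<Rightarrow> bool"
  where "is_subring A \<longleftrightarrow> 1 \<in> A \<and> (\<forall>x\<in>A. \<forall>y\<in>A. x - y \<in> A \<and> x * y \<in> A)"

definition hom_on :: "'r::comm_ring_1 set \<Rightarrow> ('r \<Rightarrow> 's::comm_ring_1) \<Rightarrow> bool"
  where "hom_on A \<phi> \<longleftrightarrow>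
    \<phi> 1 = 1 \<and> (\<forall>x\<in>A. \<forall>y\<in>A. \<phi> (x + y) = \<phi> x + \<phi> y \<and> \<phi> (x * y) = \<phi> x * \<phi> y)"

definition poly_over :: "'r::zero set \<Rightarrow> 'r poly set"
  where "poly_over A = {p. \<forall>i. coeff p i \<in> A}"

definition adjoin :: "'r::comm_ring_1 set \<Rightarrow> 'r \<Rightarrow> 'r set"
  where "adjoin A s = (\<lambda>p. poly p s) ` poly_over A"

primrec adjoin_list :: "'r::comm_ring_1 set \<Rightarrow> 'r list \<Rightarrow> 'r set"
  where "adjoin_list A [] = A"
  | "adjoin_list A (x # xs) = adjoin_list (adjoin A x) xs"

definition transcendental :: "'r::comm_ring_1 set \<Rightarrow> 'r \<Rightarrow> bool"
  where "transcendental A s \<longleftrightarrow> (\<forall>p\<in>poly_over A. poly p s = 0 \<longrightarrow> p = 0)"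

text \<open>Independence as a tower: each element is transcendental over the subring generated by
  the base and its predecessors. This form suits induction along the list and needs no fraction
  fields.\<close>

primrec alg_indep :: "'r::comm_ring_1 set \<Rightarrow> 'r list \<Rightarrow> bool"
  where "alg_indep A [] \<longleftrightarrow> True"
  | "alg_indep A (x # xs) \<longleftrightarrow> transcendental A x \<and> alg_indep (adjoin A x) xs"

lemma
  assumes "is_subring A"
  shows is_subring_1: "1 \<in> A"
    and is_subring_0: "0 \<in> A"
    and is_subring_diff: "x \<in> A \<Longrightarrow> y \<in> A \<Longrightarrow> x - y \<in> A"
    and is_subring_mult: "x \<in> A \<Longrightarrow> y \<in> A \<Longrightarrow> x * y \<in> A"
    and is_subring_uminus: "x \<in> A \<Longrightarrow> - x \<in> A"
    and is_subring_add: "x \<in> A \<Longrightarrow> y \<in> A \<Longrightarrow> x + y \<in> A"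
    and is_subring_power: "x \<in> A \<Longrightarrow> x ^ n \<in> A"
    and is_subring_of_int: "of_int k \<in> A"
    and is_subring_sum: "(\<And>i. i \<in> I \<Longrightarrow> f i \<in> A) \<Longrightarrow> sum f I \<in> A"
    and is_subring_prod: "(\<And>i. i \<in> I \<Longrightarrow> f i \<in> A) \<Longrightarrow> prod f I \<in> A"
proof -
  show 1: "1 \<in> A" and D: "x \<in> A \<Longrightarrow> y \<in> A \<Longrightarrow> x - y \<in> A"
    and M: "x \<in> A \<Longrightarrow> y \<in> A \<Longrightarrow> x * y \<in> A" for x y
    using assms by (auto simp: is_subring_def)
  show 0: "0 \<in> A" using D[OF 1 1] by simp
  show U: "x \<in> A \<Longrightarrow> - x \<in> A" for x using D[OF 0] by fastforce
  show P: "x \<in> A \<Longrightarrow> y \<in> A \<Longrightarrow> x + y \<in> A" for x y using D[of x "- y"] U by simp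
  show "x \<in> A \<Longrightarrow> x ^ n \<in> A" by (induction n) (auto intro: 1 M)
  show "of_int k \<in> A"
    by (induction k rule: int_induct[where k = 0]) (auto intro: 0 1 P D)
  show "(\<And>i. i \<in> I \<Longrightarrow> f i \<in> A) \<Longrightarrow> sum f I \<in> A"
    by (induction I rule: infinite_finite_induct) (auto intro: 0 P)
  show "(\<And>i. i \<in> I \<Longrightarrow> f i \<in> A) \<Longrightarrow> prod f I \<in> A"
    by (induction I rule: infinite_finite_induct) (auto intro: 1 M)
qed

lemma
  assumes "hom_on A \<phi>"
  shows hom_on_1: "\<phi> 1 = 1"
    and hom_on_add: "x \<in> A \<Longrightarrow> y \<in> A \<Longrightarrow> \<phi> (x + y) = \<phi> x + \<phi> y"
    and hom_on_mult: "x \<in> A \<Longrightarrow> y \<in> A \<Longrightarrow> \<phi> (x * y) = \<phi> x * \<phi> y"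
  using assms by (auto simp: hom_on_def)

lemma
  assumes "hom_on A \<phi>" and A: "is_subring A"
  shows hom_on_0: "\<phi> 0 = 0"
    and hom_on_uminus: "x \<in> A \<Longrightarrow> \<phi> (- x) = - \<phi> x"
    and hom_on_diff: "x \<in> A \<Longrightarrow> y \<in> A \<Longrightarrow> \<phi> (x - y) = \<phi> x - \<phi> y"
    and hom_on_power: "x \<in> A \<Longrightarrow> \<phi> (x ^ n) = \<phi> x ^ n"
    and hom_on_of_int: "\<phi> (of_int k) = of_int k"
    and hom_on_sum: "(\<And>i. i \<in> I \<Longrightarrow> f i \<in> A) \<Longrightarrow> \<phi> (sum f I) = (\<Sum>i\<in>I. \<phi> (f i))"
    and hom_on_prod: "(\<And>i. i \<in> I \<Longrightarrow> f i \<in> A) \<Longrightarrow> \<phi> (prod f I) = (\<Prod>i\<in>I. \<phi> (f i))"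
proof -
  note h = hom_on_1[OF assms(1)] hom_on_add[OF assms(1)] hom_on_mult[OF assms(1)]
  note A' = is_subring_0[OF A] is_subring_1[OF A] is_subring_uminus[OF A] is_subring_diff[OF A]
    is_subring_of_int[OF A] is_subring_power[OF A]
    is_subring_sum[OF A] is_subring_prod[OF A]
  show 0: "\<phi> 0 = 0" using h(2)[OF A'(1) A'(1)] by simp
  show U: "x \<in> A \<Longrightarrow> \<phi> (- x) = - \<phi> x" for x
    using h(2)[of x "- x"] A'(3)[of x] 0 by (simp add: add_eq_0_iff)
  show D: "x \<in> A \<Longrightarrow> y \<in> A \<Longrightarrow> \<phi> (x - y) = \<phi> x - \<phi> y" for x y
    using h(2)[of x "- y"] A'(3)[of y] U by simp
  show "x \<in> A \<Longrightarrow> \<phi> (x ^ n) = \<phi> x ^ n" by (induction n) (auto simp: h A')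
  show "\<phi> (of_int k) = of_int k"
    by (induction k rule: int_induct[where k = 0]) (auto simp: 0 h A' D)
  show "(\<And>i. i \<in> I \<Longrightarrow> f i \<in> A) \<Longrightarrow> \<phi> (sum f I) = (\<Sum>i\<in>I. \<phi> (f i))"
    by (induction I rule: infinite_finite_induct) (auto simp: 0 h A')
  show "(\<And>i. i \<in> I \<Longrightarrow> f i \<in> A) \<Longrightarrow> \<phi> (prod f I) = (\<Prod>i\<in>I. \<phi> (f i))"
    by (induction I rule: infinite_finite_induct) (auto simp: h A')
qed

lemma
  assumes A: "is_subring A"
  shows poly_over_0: "0 \<in> poly_over A"
    and poly_over_diff: "p \<in> poly_over A \<Longrightarrow> q \<in> poly_over A \<Longrightarrow> p - q \<in> poly_over A"
    and poly_over_add: "p \<in> poly_over A \<Longrightarrow> q \<in> poly_over A \<Longrightarrow> p + q \<in> poly_over A"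
    and poly_over_mult: "p \<in> poly_over A \<Longrightarrow> q \<in> poly_over A \<Longrightarrow> p * q \<in> poly_over A"
    and poly_over_smult: "a \<in> A \<Longrightarrow> q \<in> poly_over A \<Longrightarrow> smult a q \<in> poly_over A"
    and poly_over_monom: "a \<in> A \<Longrightarrow> monom a n \<in> poly_over A"
    and poly_over_pCons: "a \<in> A \<Longrightarrow> q \<in> poly_over A \<Longrightarrow> pCons a q \<in> poly_over A"
  unfolding poly_over_def
  by (auto simp: coeff_mult coeff_pCons is_subring_0[OF A] is_subring_1[OF A]
    is_subring_uminus[OF A] split: nat.split
      intro!: is_subring_diff[OF A] is_subring_sum[OF A] is_subring_mult[OF A] is_subring_add[OF A])

lemma poly_over_coeff: "p \<in> poly_over A \<Longrightarrow> coeff p i \<in> A"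
  by (simp add: poly_over_def)

lemma adjoinI: "p \<in> poly_over A \<Longrightarrow> poly p s \<in> adjoin A s"
  by (auto simp: adjoin_def)

lemma adjoinE: "x \<in> adjoin A s \<Longrightarrow> (\<And>p. p \<in> poly_over A \<Longrightarrow> x = poly p s \<Longrightarrow> P) \<Longrightarrow> P"
  by (auto simp: adjoin_def)

lemma adjoin_base:
  assumes "is_subring A"
  shows "A \<subseteq> adjoin A s"
proof
  fix a assume "a \<in> A"
  then have "[:a:] \<in> poly_over A"
    by (intro poly_over_pCons assms poly_over_0)
  from adjoinI[OF this] show "a \<in> adjoin A s" by simp
qed

lemma adjoin_gen: "is_subring A \<Longrightarrow> s \<in> adjoin A s"
  using adjoinI[OF poly_over_pCons[OF _ is_subring_0 poly_over_pCons[OF _ is_subring_1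
    poly_over_0]], of A s] by simp

lemma is_subring_adjoin:
  assumes A: "is_subring A"
  shows "is_subring (adjoin A s)"
proof -
  have "1 \<in> adjoin A s" using adjoin_base[OF A] is_subring_1[OF A] by blast
  moreover have "x - y \<in> adjoin A s \<and> x * y \<in> adjoin A s" if xy: "x \<in> adjoin A s" "y \<in> adjoin A s"
    for x y
  proof -
    obtain p q where "p \<in> poly_over A" "q \<in> poly_over A" "x = poly p s" "y = poly q s"
      using xy by (auto simp: adjoin_def)
    then show ?thesis
      using adjoinI[OF poly_over_diff[OF A], of p q s] adjoinI[OF poly_over_mult[OF A], of p q s]
        by simp
  qed
  ultimately show ?thesis by (auto simp: is_subring_def)
qed

lemma adjoin_least:
  assumes "is_subring S" "A \<subseteq> S" "s \<in> S"
  shows "adjoin A s \<subseteq> S"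
  using assms(2,3) by (auto elim!: adjoinE simp: poly_altdef poly_over_def subset_iff
      intro!: is_subring_sum[OF assms(1)] is_subring_mult[OF assms(1)]
        is_subring_power[OF assms(1)])

lemma is_subring_adjoin_list: "is_subring A \<Longrightarrow> is_subring (adjoin_list A xs)"
  by (induction xs arbitrary: A) (auto simp: is_subring_adjoin)

lemma adjoin_list_base: "is_subring A \<Longrightarrow> A \<subseteq> adjoin_list A xs"
  by (induction xs arbitrary: A) (auto dest: is_subring_adjoin intro: subsetD[OF adjoin_base])

lemma adjoin_list_gen: "is_subring A \<Longrightarrow> set xs \<subseteq> adjoin_list A xs"
proof (induction xs arbitrary: A)
  case (Cons x xs)
  then show ?case
    using is_subring_adjoin[OF Cons.prems] adjoin_list_base[OF
      is_subring_adjoin[OF Cons.prems, of x], of xs]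
      adjoin_gen[OF Cons.prems, of x] by auto
qed simp

lemma adjoin_list_least: "is_subring S \<Longrightarrow> A \<subseteq> S \<Longrightarrow> set xs \<subseteq> S \<Longrightarrow> adjoin_list A xs \<subseteq> S"
  by (induction xs arbitrary: A) (auto dest: adjoin_least)

lemma alg_indep_append: "alg_indep A (xs @ ys) \<longleftrightarrow> alg_indep A xs \<and> alg_indep (adjoin_list A xs) ys"
  by (induction xs arbitrary: A) auto

lemma transcendental_mono: "transcendental B s \<Longrightarrow> A \<subseteq> B \<Longrightarrow> transcendental A s"
  by (auto simp: transcendental_def poly_over_def)

lemma not_transcendental_mem:
  assumes A: "is_subring A" and "s \<in> A"
  shows "\<not> transcendental A s"
proof -
  have "[:-s, 1:] \<in> poly_over A"
    by (intro poly_over_pCons A poly_over_0 is_subring_uminus[OF A] is_subring_1[OF A] assms)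
  moreover have "poly [:-s, 1:] s = 0" by simp
  ultimately show ?thesis unfolding transcendental_def by force
qed

lemma alg_indep_distinct:
  assumes "is_subring A" "alg_indep A xs"
  shows "distinct xs \<and> set xs \<inter> A = {}"
  using assms
proof (induction xs arbitrary: A)
  case (Cons x xs)
  note B = is_subring_adjoin[OF Cons.prems(1), of x]
  have "distinct xs \<and> set xs \<inter> adjoin A x = {}"
    by (rule Cons.IH) (use Cons.prems B in auto)
  then show ?case
    using adjoin_base[OF Cons.prems(1), of x] adjoin_gen[OF Cons.prems(1), of x] Cons.prems
      not_transcendental_mem[of A x] by auto
qed simp

lemma coeff_map_hom:
  "hom_on A \<phi> \<Longrightarrow> is_subring A \<Longrightarrow> coeff (map_poly \<phi> p) i = \<phi> (coeff p i)"
  by (simp add: coeff_map_poly hom_on_0)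

lemma
  assumes h: "hom_on A \<phi>" and A: "is_subring A"
    and p: "p \<in> poly_over A" and q: "q \<in> poly_over A"
  shows map_poly_add_on: "map_poly \<phi> (p + q) = map_poly \<phi> p + map_poly \<phi> q"
    and map_poly_diff_on: "map_poly \<phi> (p - q) = map_poly \<phi> p - map_poly \<phi> q"
    and map_poly_mult_on: "map_poly \<phi> (p * q) = map_poly \<phi> p * map_poly \<phi> q"
    and map_poly_smult_on: "a \<in> A \<Longrightarrow> map_poly \<phi> (smult a p) = smult (\<phi> a) (map_poly \<phi> p)"
  using poly_over_coeff[OF p] poly_over_coeff[OF q]
  by (intro poly_eqI; simp add: coeff_map_hom[OF h A] hom_on_add[OF h] hom_on_diff[OF h A]
      hom_on_mult[OF h] coeff_mult hom_on_sum[OF h A] is_subring_mult[OF A])+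

lemma poly_map_hom:
  assumes "hom_on S \<phi>" "is_subring S" "A \<subseteq> S" "s \<in> S" "p \<in> poly_over A" "is_subring A"
  shows "\<phi> (poly p s) = poly (map_poly \<phi> p) (\<phi> s)"
  using assms(5)
proof (induction p)
  case 0
  then show ?case by (simp add: hom_on_0[OF assms(1,2)])
next
  case (pCons a p)
  have a: "a \<in> A" using poly_over_coeff[OF pCons.prems, of 0] by simp
  have "coeff p i \<in> A" for i using poly_over_coeff[OF pCons.prems, of "Suc i"] by simp
  then have p: "p \<in> poly_over A" by (simp add: poly_over_def)
  have "poly p s \<in> S"
    using adjoin_least[OF assms(2,3,4)] adjoinI[OF p] by blast
  moreover have "map_poly \<phi> (pCons a p) = pCons (\<phi> a) (map_poly \<phi> p)"
    by (rule map_poly_pCons[where f = \<phi>, OF hom_on_0[OF assms(1,2)]])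
  ultimately show ?case
    using pCons.IH[OF p] a assms(3,4)
    by (simp add: hom_on_add[OF assms(1)] hom_on_mult[OF assms(1)]
      is_subring_mult[OF assms(2)] subset_iff)
qed

lemma hom_image_adjoin:
  assumes "hom_on S \<phi>" "is_subring S" "A \<subseteq> S" "s \<in> S" "is_subring A"
  shows "\<phi> ` adjoin A s = adjoin (\<phi> ` A) (\<phi> s)"
proof (intro subset_antisym subsetI)
  fix y assume "y \<in> \<phi> ` adjoin A s"
  then obtain p where p: "p \<in> poly_over A" "y = \<phi> (poly p s)"
    by (auto simp: adjoin_def)
  have "map_poly \<phi> p \<in> poly_over (\<phi> ` A)"
    using p(1) by (auto simp: poly_over_def coeff_map_hom[OF assms(1,2)])
  from adjoinI[OF this] show "y \<in> adjoin (\<phi> ` A) (\<phi> s)"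
    using p poly_map_hom[OF assms(1-4) p(1) assms(5)] by simp
next
  fix y assume "y \<in> adjoin (\<phi> ` A) (\<phi> s)"
  then obtain q where q: "q \<in> poly_over (\<phi> ` A)" "y = poly q (\<phi> s)"
    by (auto simp: adjoin_def)
  from q(1) have "\<forall>i. \<exists>a. a \<in> A \<and> coeff q i = \<phi> a"
    by (auto simp: poly_over_def)
  then obtain a where a: "\<And>i. a i \<in> A" "\<And>i. coeff q i = \<phi> (a i)"
    by metis
  define p where "p = (\<Sum>i\<le>degree q. monom (a i) i)"
  have cp: "coeff p i = (if i \<le> degree q then a i else 0)" for i
    by (simp add: p_def coeff_sum)
  have p: "p \<in> poly_over A"
    using a(1) by (simp add: poly_over_def cp is_subring_0[OF assms(5)])
  have "map_poly \<phi> p = q"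
    by (intro poly_eqI) (auto simp: coeff_map_hom[OF assms(1,2)] cp a(2)[symmetric]
        hom_on_0[OF assms(1,2)] coeff_eq_0)
  then show "y \<in> \<phi> ` adjoin A s"
    using imageI[OF adjoinI[OF p, of s], of \<phi>] q(2) poly_map_hom[OF assms(1-4) p assms(5)] by simp
qed

lemma hom_on_subset: "hom_on S \<phi> \<Longrightarrow> A \<subseteq> S \<Longrightarrow> hom_on A \<phi>"
  by (auto simp: hom_on_def)

lemma hom_image_subring:
  assumes "hom_on A \<phi>" "is_subring A"
  shows "is_subring (\<phi> ` A)"
  unfolding is_subring_def
proof (intro conjI ballI)
  show "1 \<in> \<phi> ` A"
    using imageI[OF is_subring_1[OF assms(2)], of \<phi>] hom_on_1[OF assms(1)] by simp
  fix x y assume "x \<in> \<phi> ` A" "y \<in> \<phi> ` A"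
  then obtain a b where "a \<in> A" "b \<in> A" "x = \<phi> a" "y = \<phi> b" by blast
  then show "x - y \<in> \<phi> ` A" "x * y \<in> \<phi> ` A"
    using imageI[OF is_subring_diff[OF assms(2)], of a b \<phi>] imageI[OF
      is_subring_mult[OF assms(2)], of a b \<phi>]
    by (simp_all add: hom_on_diff[OF assms] hom_on_mult[OF assms(1)])
qed

text \<open>A relation among the elements maps to a relation among their images, which must be
  trivial; since \<phi> is injective on the base, the coefficients vanish already before mapping.
  The same argument shows that injectivity survives each adjunction, which keeps the induction
  going.\<close>

lemma alg_indep_pullback:
  assumes "hom_on S \<phi>" "is_subring S" "is_subring A" "A \<subseteq> S" "set xs \<subseteq> S"
    and "\<forall>x\<in>A. \<phi> x = 0 \<longrightarrow> x = 0"
    and "alg_indep (\<phi> ` A) (map \<phi> xs)"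
  shows "alg_indep A xs \<and> (\<forall>x\<in>adjoin_list A xs. \<phi> x = 0 \<longrightarrow> x = 0)"
  using assms(3-)
proof (induction xs arbitrary: A)
  case (Cons x xs)
  note h = assms(1,2)
  have x: "x \<in> S" using Cons.prems by simp
  have tr: "p = 0" if p: "p \<in> poly_over A" and "\<phi> (poly p x) = 0" for p
  proof -
    have "poly (map_poly \<phi> p) (\<phi> x) = 0"
      using that poly_map_hom[OF h Cons.prems(2) x p Cons.prems(1)] by simp
    moreover have "map_poly \<phi> p \<in> poly_over (\<phi> ` A)"
      using p by (auto simp: poly_over_def coeff_map_hom[OF h])
    ultimately have "map_poly \<phi> p = 0"
      using Cons.prems(5) by (auto simp: transcendental_def)
    then have "\<phi> (coeff p i) = 0" for i
      using coeff_map_hom[OF h, of p i] by simp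
    then show "p = 0" using Cons.prems(4) p by (auto simp: poly_over_def intro: poly_eqI)
  qed
  have "alg_indep (adjoin A x) xs \<and> (\<forall>y\<in>adjoin_list (adjoin A x) xs. \<phi> y = 0 \<longrightarrow> y = 0)"
  proof (rule Cons.IH)
    show "\<forall>y\<in>adjoin A x. \<phi> y = 0 \<longrightarrow> y = 0"
      using tr by (metis adjoinE poly_0)
    show "alg_indep (\<phi> ` adjoin A x) (map \<phi> xs)"
      using Cons.prems(5) hom_image_adjoin[OF h Cons.prems(2) x Cons.prems(1)] by simp
  qed (use Cons.prems is_subring_adjoin adjoin_least[OF assms(2) Cons.prems(2) x] in auto)
  moreover have "transcendental A x"
    unfolding transcendental_def using tr hom_on_0[OF h] by metis
  ultimately show ?case by simp
qed simp

text \<open>\<open>A\<close> is a subset of the domain in which leading coefficients need not be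
  invertible; the point is that quotient and remainder keep their coefficients in
  \<open>A\<close>.\<close>

lemma pseudo_division:
  fixes p :: "'r::idom poly"
  assumes A: "is_subring A" and p: "p \<in> poly_over A" "p \<noteq> 0" and f: "f \<in> poly_over A"
  obtains k q r where "q \<in> poly_over A" "r \<in> poly_over A"
    "smult (lead_coeff p ^ k) f = p * q + r" "r = 0 \<or> degree r < degree p"
proof -
  have "\<exists>k q r. q \<in> poly_over A \<and> r \<in> poly_over A \<and>
    smult (lead_coeff p ^ k) f = p * q + r \<and> (r = 0 \<or> degree r < degree p)"
    using f
  proof (induction "degree f" arbitrary: f rule: less_induct)
    case less
    show ?case
    proof (cases "f = 0 \<or> degree f < degree p")
      case True
      then show ?thesis using less.prems poly_over_0[OF A] by (intro exI[of _ 0] exI[of _ f]) auto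
    next
      case False
      define m where "m = monom (lead_coeff f) (degree f - degree p)"
      define g where "g = smult (lead_coeff p) f - p * m"
      have m: "m \<in> poly_over A"
        unfolding m_def by (intro poly_over_monom A poly_over_coeff less.prems)
      have g: "g \<in> poly_over A"
        unfolding g_def by (intro poly_over_diff poly_over_smult poly_over_mult A m p
          poly_over_coeff less.prems)
      have dm: "degree (p * m) = degree f"
        using False p by (simp add: m_def degree_mult_eq degree_monom_eq)
      have cm: "coeff (p * m) (degree f) = lead_coeff p * lead_coeff f"
        using False p by (metis dm lead_coeff_mult lead_coeff_monom m_def)
      have "coeff g i = 0" if "i \<ge> degree f" for i
        using that cm dm by (cases "i = degree f") (auto simp: g_def coeff_eq_0)
      then have "g = 0 \<or> degree g < degree f"
        by (metis leading_coeff_0_iff not_le_imp_less)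
      then have "\<exists>k q r. q \<in> poly_over A \<and> r \<in> poly_over A \<and>
        smult (lead_coeff p ^ k) g = p * q + r \<and> (r = 0 \<or> degree r < degree p)"
        using less.hyps[OF _ g] poly_over_0[OF A] by (cases "g = 0") auto
      then obtain k q r where *: "q \<in> poly_over A" "r \<in> poly_over A"
        "smult (lead_coeff p ^ k) g = p * q + r" "r = 0 \<or> degree r < degree p"
        by blast
      have "smult (lead_coeff p ^ Suc k) f = p * (q + smult (lead_coeff p ^ k) m) + r"
        using *(3) by (simp add: g_def algebra_simps smult_diff_right)
      moreover have "q + smult (lead_coeff p ^ k) m \<in> poly_over A"
        by (intro poly_over_add poly_over_smult A * m is_subring_power[OF A] poly_over_coeff p)
      ultimately show ?thesis using * by blast
    qed
  qed
  then show ?thesis using that by blast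
qed

text \<open>
  As the subring need not be a field, least degree gives divisibility only up to powers of the
  leading coefficient.
\<close>

definition is_minpoly :: "'r::comm_ring_1 set \<Rightarrow> 'r \<Rightarrow> 'r poly \<Rightarrow> bool"
  where "is_minpoly A s p \<longleftrightarrow> p \<in> poly_over A \<and> p \<noteq> 0 \<and> poly p s = 0 \<and>
    (\<forall>q\<in>poly_over A. poly q s = 0 \<longrightarrow> q \<noteq> 0 \<longrightarrow> degree p \<le> degree q)"

lemma is_minpoly_ex:
  assumes "\<not> transcendental A s"
  obtains p where "is_minpoly A s p"
proof -
  obtain p where p: "p \<in> poly_over A \<and> poly p s = 0 \<and> p \<noteq> 0"
    using assms by (auto simp: transcendental_def)
  from ex_has_least_nat[of "\<lambda>p. p \<in> poly_over A \<and> poly p s = 0 \<and> p \<noteq> 0", OF this, of degree]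
  show ?thesis using that unfolding is_minpoly_def by blast
qed

lemma is_minpoly_degree:
  assumes "is_minpoly A s p"
  shows "degree p > 0"
proof (rule gr0I)
  assume "degree p = 0"
  then obtain a where "p = [:a:]" by (auto elim: degree_eq_zeroE)
  then show False using assms by (simp add: is_minpoly_def)
qed

lemma is_minpoly_unique_0:
  assumes "is_minpoly A s p" "q \<in> poly_over A" "poly q s = 0" "q = 0 \<or> degree q < degree p"
  shows "q = 0"
  using assms unfolding is_minpoly_def by (meson leD)

lemma minpoly_pseudo_dvd:
  fixes s :: "'r::idom"
  assumes A: "is_subring A" and p: "is_minpoly A s p"
    and f: "f \<in> poly_over A" "poly f s = 0"
  obtains k q where "q \<in> poly_over A" "smult (lead_coeff p ^ k) f = p * q"
proof -
  have pA: "p \<in> poly_over A" "p \<noteq> 0" using p by (auto simp: is_minpoly_def)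
  obtain k q r where *: "q \<in> poly_over A" "r \<in> poly_over A"
    "smult (lead_coeff p ^ k) f = p * q + r" "r = 0 \<or> degree r < degree p"
    using pseudo_division[OF A pA f(1)] .
  have "poly (smult (lead_coeff p ^ k) f) s = 0" using f by simp
  then have "poly r s = 0" using *(3) p by (simp add: is_minpoly_def)
  then have "r = 0" using is_minpoly_unique_0[OF p *(2)] *(4) by blast
  then show ?thesis using *(3) that[OF *(1), of k] by simp
qed

text \<open>A Euclidean descent: with b = f(s) and f of smaller degree than the minimal polynomial
  p, pseudo-dividing p by f shows that r(s) is a multiple of f(s), and r has smaller degree. The
  descent ends at a nonzero constant polynomial, that is, in \<open>A\<close>.\<close>

lemma algebraic_multiple:
  fixes s :: "'r::idom"
  assumes A: "is_subring A" and s: "\<not> transcendental A s" and b: "b \<in> adjoin A s" "b \<noteq> 0"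
  shows "\<exists>u\<in>adjoin A s. u * b \<in> A \<and> u * b \<noteq> 0"
proof -
  obtain p where p: "is_minpoly A s p" using is_minpoly_ex[OF s] .
  then have pA: "p \<in> poly_over A" "p \<noteq> 0" "poly p s = 0" by (auto simp: is_minpoly_def)
  note S = is_subring_adjoin[OF A, of s]
  have small: "\<exists>u\<in>adjoin A s. u * poly f s \<in> A \<and> u * poly f s \<noteq> 0"
    if "f \<in> poly_over A" "poly f s \<noteq> 0" "degree f < degree p" for f
    using that
  proof (induction "degree f" arbitrary: f rule: less_induct)
    case less
    have f0: "f \<noteq> 0" using less.prems by auto
    show ?case
    proof (cases "degree f = 0")
      case True
      then obtain a where "f = [:a:]" by (auto elim: degree_eq_zeroE)
      then show ?thesis
        using less.prems is_subring_1[OF S] poly_over_coeff[OF less.prems(1), of 0]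
          by (intro bexI[of _ 1]) auto
    next
      case False
      obtain k q r where *: "q \<in> poly_over A" "r \<in> poly_over A"
        "smult (lead_coeff f ^ k) p = f * q + r" "r = 0 \<or> degree r < degree f"
        using pseudo_division[OF A less.prems(1) f0 pA(1)] .
      have fq: "poly f s * poly q s + poly r s = 0"
        using arg_cong[OF *(3), of "\<lambda>g. poly g s"] pA by simp
      \<comment> \<open>Otherwise r = 0 by minimality, and f divides a multiple of p; the cofactor q
        would vanish at s and have smaller degree than p.\<close>
      have "poly r s \<noteq> 0"
      proof
        assume r0: "poly r s = 0"
        have "r = 0"
          using is_minpoly_unique_0[OF p *(2) r0] *(4) less.prems(3) by linarith
        with fq less.prems have q0: "poly q s = 0" by simp
        have eq: "smult (lead_coeff f ^ k) p = f * q" using * \<open>r = 0\<close> by simp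
        then have "q \<noteq> 0" using pA f0 by auto
        moreover have "degree p = degree f + degree q"
          using arg_cong[OF eq, of degree] f0 \<open>q \<noteq> 0\<close> by (simp add: degree_mult_eq)
        ultimately show False using is_minpoly_unique_0[OF p *(1) q0] False by simp
      qed
      then have "degree r < degree f" using * by auto
      then obtain u where u: "u \<in> adjoin A s" "u * poly r s \<in> A" "u * poly r s \<noteq> 0"
        using less.hyps[OF _ *(2) \<open>poly r s \<noteq> 0\<close>] less.prems by auto
      have "(- u * poly q s) * poly f s = u * poly r s"
        using fq by (simp add: add_eq_0_iff algebra_simps)
      moreover have "- u * poly q s \<in> adjoin A s"
        by (intro is_subring_mult[OF S] is_subring_uminus[OF S] u adjoinI *)
      ultimately show ?thesis using u by metis
    qed
  qed
  \<comment> \<open>The representing polynomial is first reduced modulo p; the power of the leading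
    coefficient is absorbed into the multiplier.\<close>
  obtain f where f: "f \<in> poly_over A" "b = poly f s" using b by (auto elim: adjoinE)
  obtain k q r where *: "q \<in> poly_over A" "r \<in> poly_over A"
    "smult (lead_coeff p ^ k) f = p * q + r" "r = 0 \<or> degree r < degree p"
    using pseudo_division[OF A pA(1,2) f(1)] .
  have rb: "poly r s = lead_coeff p ^ k * b"
    using arg_cong[OF *(3), of "\<lambda>g. poly g s"] pA f by simp
  then have "poly r s \<noteq> 0" using b pA by simp
  moreover from this have "degree r < degree p" using * by auto
  ultimately obtain u where u: "u \<in> adjoin A s" "u * poly r s \<in> A" "u * poly r s \<noteq> 0"
    using small[OF *(2)] by blast
  have "u * lead_coeff p ^ k \<in> adjoin A s"
    using adjoin_base[OF A] poly_over_coeff[OF pA(1)] by (intro is_subring_mult[OF S] u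
      is_subring_power[OF S]) auto
  then show ?thesis using u rb by (metis mult.assoc)
qed

lemma algebraic_multiple_list:
  fixes xs :: "'r::idom list"
  assumes "is_subring A" "\<forall>x\<in>set xs. \<not> transcendental A x" "b \<in> adjoin_list A xs" "b \<noteq> 0"
  shows "\<exists>u\<in>adjoin_list A xs. u * b \<in> A \<and> u * b \<noteq> 0"
  using assms
proof (induction xs arbitrary: A)
  case Nil
  then show ?case by (intro bexI[of _ 1]) (auto simp: is_subring_1)
next
  case (Cons x xs)
  note B = is_subring_adjoin[OF Cons.prems(1), of x]
  have "\<forall>y\<in>set xs. \<not> transcendental (adjoin A x) y"
    using Cons.prems transcendental_mono[OF _ adjoin_base[OF Cons.prems(1)]] by auto
  then obtain u where u: "u \<in> adjoin_list (adjoin A x) xs" "u * b \<in> adjoin A x" "u * b \<noteq> 0"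
    using Cons.IH[OF B] Cons.prems by auto
  obtain v where v: "v \<in> adjoin A x" "v * (u * b) \<in> A" "v * (u * b) \<noteq> 0"
    using algebraic_multiple[OF Cons.prems(1) _ u(2,3)] Cons.prems by auto
  have "v * u \<in> adjoin_list (adjoin A x) xs"
    using adjoin_list_base[OF B] v(1) u(1) by (intro is_subring_mult[OF
      is_subring_adjoin_list[OF B]]) auto
  then show ?case using v by (intro bexI[of _ "v * u"]) (auto simp: mult.assoc)
qed

subsection \<open>Extending homomorphisms into an algebraically closed field\<close>

lemma hom_extend:
  assumes A: "is_subring A" and h: "hom_on A \<phi>"
    and w: "\<And>f. f \<in> poly_over A \<Longrightarrow> poly f s = 0 \<Longrightarrow> poly (map_poly \<phi> f) \<omega> = 0"
  shows "\<exists>\<psi>. hom_on (adjoin A s) \<psi> \<and> (\<forall>a\<in>A. \<psi> a = \<phi> a) \<and>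
    (\<forall>f\<in>poly_over A. \<psi> (poly f s) = poly (map_poly \<phi> f) \<omega>)"
proof -
  \<comment> \<open>An arbitrary representing polynomial is chosen; by \<open>w\<close> the value
    does not depend on the choice.\<close>
  define \<psi> where "\<psi> x = poly (map_poly \<phi> (SOME f. f \<in> poly_over A \<and> poly f s = x)) \<omega>" for x
  have \<psi>: "\<psi> (poly f s) = poly (map_poly \<phi> f) \<omega>" if f: "f \<in> poly_over A" for f
  proof -
    define g where "g = (SOME g. g \<in> poly_over A \<and> poly g s = poly f s)"
    have g: "g \<in> poly_over A \<and> poly g s = poly f s"
      unfolding g_def by (rule someI[of _ f]) (use f in simp)
    have "poly (map_poly \<phi> (g - f)) \<omega> = 0"
      by (rule w) (use g f poly_over_diff[OF A] in auto)
    then show ?thesis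
      using map_poly_diff_on[OF h A, of g f] g f by (simp add: \<psi>_def g_def[symmetric])
  qed
  have base: "\<psi> a = \<phi> a" if "a \<in> A" for a
    using \<psi>[of "[:a:]"] poly_over_pCons[OF A that poly_over_0[OF A]]
    by (simp add: map_poly_pCons[where f = \<phi>, OF hom_on_0[OF h A]])
  have "hom_on (adjoin A s) \<psi>"
    unfolding hom_on_def
  proof (intro conjI ballI)
    show "\<psi> 1 = 1" using base[OF is_subring_1[OF A]] hom_on_1[OF h] by simp
    fix x y assume "x \<in> adjoin A s" "y \<in> adjoin A s"
    then obtain f g where fg: "f \<in> poly_over A" "g \<in> poly_over A" "x = poly f s" "y = poly g s"
      by (auto elim!: adjoinE)
    show "\<psi> (x + y) = \<psi> x + \<psi> y"
      using \<psi>[OF poly_over_add[OF A fg(1,2)]] map_poly_add_on[OF h A fg(1,2)] fg \<psi> by simp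
    show "\<psi> (x * y) = \<psi> x * \<psi> y"
      using \<psi>[OF poly_over_mult[OF A fg(1,2)]] map_poly_mult_on[OF h A fg(1,2)] fg \<psi> by simp
  qed
  then show ?thesis using base \<psi> by blast
qed

lemma non_root_ex:
  fixes q :: "'k::field_char_0 poly"
  assumes "q \<noteq> 0" "infinite W"
  shows "\<exists>w\<in>W. poly q w \<noteq> 0"
  using poly_roots_finite[OF assms(1)] assms(2) finite_subset[of W "{x. poly q x = 0}"] by blast

text \<open>One adjunction in the extension theorem for homomorphisms into an algebraically closed
  field: the demand that b survive is turned into the demand that a single element a of the smaller
  ring survive.\<close>

lemma hom_extend_nonzero:
  fixes A :: "'r::idom set" and s b :: 'r
  assumes A: "is_subring A" and b: "b \<in> adjoin A s" "b \<noteq> 0"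
  obtains a where "a \<in> A" "a \<noteq> 0"
    "\<And>\<phi> :: 'r \<Rightarrow> 'k::{alg_closed_field,field_char_0}. hom_on A \<phi> \<Longrightarrow> \<phi> a \<noteq> 0 \<Longrightarrow>
      \<exists>\<psi>. hom_on (adjoin A s) \<psi> \<and> (\<forall>a\<in>A. \<psi> a = \<phi> a) \<and> \<psi> b \<noteq> 0"
proof (cases "transcendental A s")
  case True
  obtain f where f: "f \<in> poly_over A" "b = poly f s" using b by (auto elim: adjoinE)
  have f0: "f \<noteq> 0" using b f by auto
  show ?thesis
  proof (rule that)
    \<comment> \<open>If \<phi> keeps this coefficient, the image of f is a nonzero polynomial, and
      all but finitely many values for s keep b nonzero.\<close>
    show "lead_coeff f \<in> A" "lead_coeff f \<noteq> 0" using f f0 poly_over_coeff by auto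
    fix \<phi> :: "'r \<Rightarrow> 'k" assume h: "hom_on A \<phi>" and nz: "\<phi> (lead_coeff f) \<noteq> 0"
    have "map_poly \<phi> f \<noteq> 0"
      using nz coeff_map_hom[OF h A, of f "degree f"] by auto
    then obtain w where w: "poly (map_poly \<phi> f) w \<noteq> 0"
      using non_root_ex[OF _ infinite_UNIV_char_0] by blast
    have "poly (map_poly \<phi> g) w = 0" if "g \<in> poly_over A" "poly g s = 0" for g
      using that True by (auto simp: transcendental_def)
    from hom_extend[OF A h this]
    show "\<exists>\<psi>. hom_on (adjoin A s) \<psi> \<and> (\<forall>a\<in>A. \<psi> a = \<phi> a) \<and> \<psi> b \<noteq> 0"
      using f w by metis
  qed
next
  case False
  obtain p where p: "is_minpoly A s p" using is_minpoly_ex[OF False] .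
  then have pA: "p \<in> poly_over A" "p \<noteq> 0" "poly p s = 0" by (auto simp: is_minpoly_def)
  obtain u where u: "u \<in> adjoin A s" "u * b \<in> A" "u * b \<noteq> 0"
    using algebraic_multiple[OF A False b] by blast
  show ?thesis
  proof (rule that)
    have lc: "lead_coeff p \<in> A" using pA poly_over_coeff by auto
    \<comment> \<open>The first factor keeps the image of the minimal polynomial nonconstant, so
      that it has a root; the second is a multiple of b inside \<open>A\<close>, so that a nonzero
      image of it forces \<psi> b \<noteq> 0.\<close>
    show "lead_coeff p * (u * b) \<in> A" "lead_coeff p * (u * b) \<noteq> 0"
      using u pA lc is_subring_mult[OF A] by auto
    fix \<phi> :: "'r \<Rightarrow> 'k" assume h: "hom_on A \<phi>" and nz: "\<phi> (lead_coeff p * (u * b)) \<noteq> 0"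
    then have nz: "\<phi> (lead_coeff p) \<noteq> 0" "\<phi> (u * b) \<noteq> 0"
      using lc u by (auto simp: hom_on_mult[OF h])
    have "coeff (map_poly \<phi> p) (degree p) \<noteq> 0"
      using nz by (simp add: coeff_map_hom[OF h A])
    then have "degree (map_poly \<phi> p) > 0"
      using is_minpoly_degree[OF p] le_degree[of "map_poly \<phi> p" "degree p"] by linarith
    then obtain w where w: "poly (map_poly \<phi> p) w = 0"
      using alg_closed_imp_poly_has_root by blast
    \<comment> \<open>Up to a power of the leading coefficient, which \<phi> does not kill, every
      relation of s is a multiple of p.\<close>
    have "poly (map_poly \<phi> g) w = 0" if g: "g \<in> poly_over A" "poly g s = 0" for g
    proof -
      obtain k q where kq: "q \<in> poly_over A" "smult (lead_coeff p ^ k) g = p * q"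
        using minpoly_pseudo_dvd[OF A p g] by blast
      have "map_poly \<phi> (smult (lead_coeff p ^ k) g) = map_poly \<phi> p * map_poly \<phi> q"
        using kq map_poly_mult_on[OF h A pA(1)] by simp
      then have "smult (\<phi> (lead_coeff p) ^ k) (map_poly \<phi> g) = map_poly \<phi> p * map_poly \<phi> q"
        using map_poly_smult_on[OF h A g(1) g(1) is_subring_power[OF A lc]]
          hom_on_power[OF h A lc] by simp
      from arg_cong[OF this, of "\<lambda>f. poly f w"] show ?thesis using w nz by simp
    qed
    from hom_extend[OF A h this] obtain \<psi> where
      \<psi>: "hom_on (adjoin A s) \<psi>" "\<And>a. a \<in> A \<Longrightarrow> \<psi> a = \<phi> a" by blast
    have "\<psi> u * \<psi> b \<noteq> 0"
      using hom_on_mult[OF \<psi>(1) u(1) b(1)] \<psi>(2)[OF u(2)] nz by simp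
    then show "\<exists>\<psi>. hom_on (adjoin A s) \<psi> \<and> (\<forall>a\<in>A. \<psi> a = \<phi> a) \<and> \<psi> b \<noteq> 0"
      using \<psi> by auto
  qed
qed

text \<open>The element a is found before \<phi> is given, so the homomorphism on \<open>A\<close>
  can later be chosen to suit it. The induction passes the element that has to survive down through
  the generators.\<close>

lemma hom_extend_nonzero_list:
  fixes A :: "'r::idom set" and xs :: "'r list"
  assumes "is_subring A" and "b \<in> adjoin_list A xs" "b \<noteq> 0"
  shows "\<exists>a\<in>A. a \<noteq> 0 \<and> (\<forall>\<phi> :: 'r \<Rightarrow> 'k::{alg_closed_field,field_char_0}.
      hom_on A \<phi> \<longrightarrow> \<phi> a \<noteq> 0 \<longrightarrow>
      (\<exists>\<psi>. hom_on (adjoin_list A xs) \<psi> \<and> (\<forall>a\<in>A. \<psi> a = \<phi> a) \<and> \<psi> b \<noteq> 0))"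
  using assms
proof (induction xs arbitrary: A)
  case Nil
  then show ?case by auto
next
  case (Cons x xs)
  note B = is_subring_adjoin[OF Cons.prems(1), of x]
  obtain b' where b': "b' \<in> adjoin A x" "b' \<noteq> 0" and ext: "\<And>\<phi> :: 'r \<Rightarrow> 'k. hom_on (adjoin A x) \<phi> \<Longrightarrow>
      \<phi> b' \<noteq> 0 \<Longrightarrow> \<exists>\<psi>. hom_on (adjoin_list (adjoin A x) xs) \<psi> \<and> (\<forall>a\<in>adjoin A x. \<psi> a = \<phi> a) \<and> \<psi> b \<noteq> 0"
    using Cons.IH[OF B] Cons.prems by auto
  obtain a where a: "a \<in> A" "a \<noteq> 0" and ext': "\<And>\<phi> :: 'r \<Rightarrow> 'k. hom_on A \<phi> \<Longrightarrow> \<phi> a \<noteq> 0 \<Longrightarrow>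
      \<exists>\<psi>. hom_on (adjoin A x) \<psi> \<and> (\<forall>a\<in>A. \<psi> a = \<phi> a) \<and> \<psi> b' \<noteq> 0"
    using hom_extend_nonzero[OF Cons.prems(1) b'] by blast
  have "\<exists>\<psi>. hom_on (adjoin_list (adjoin A x) xs) \<psi> \<and> (\<forall>a\<in>A. \<psi> a = \<phi> a) \<and> \<psi> b \<noteq> 0"
    if "hom_on A \<phi>" "\<phi> a \<noteq> 0" for \<phi> :: "'r \<Rightarrow> 'k"
    using ext'[OF that] ext adjoin_base[OF Cons.prems(1), of x] by (metis subsetD)
  then show ?case using a by auto
qed

subsection \<open>Transcendence rank of a finite family\<close>

definition trdeg :: "'r::comm_ring_1 set \<Rightarrow> ('i::finite \<Rightarrow> 'r) \<Rightarrow> nat"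
  where "trdeg A f = Max {length xs | xs. alg_indep A (map f xs)}"

text \<open>Independent entries are distinct, hence so are their indices, which bounds the lengths
  by the size of the index type. The empty list makes the set nonempty, so that \<open>Max\<close>
  is meaningful.\<close>

lemma trdeg_set:
  fixes f :: "'i::finite \<Rightarrow> 'r::comm_ring_1"
  assumes "is_subring A"
  shows "finite {length xs | xs. alg_indep A (map f xs)}"
    "{length xs | xs. alg_indep A (map f xs)} \<noteq> {}"
proof -
  have "length xs \<le> CARD('i)" if "alg_indep A (map f xs)" for xs
  proof -
    have "distinct xs" using alg_indep_distinct[OF assms that] by (simp add: distinct_map)
    then have "length xs = card (set xs)" by (simp add: distinct_card)
    then show ?thesis by (simp add: card_mono)
  qed
  then have "{length xs | xs. alg_indep A (map f xs)} \<subseteq> {..CARD('i)}" by auto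
  then show "finite {length xs | xs. alg_indep A (map f xs)}" by (rule finite_subset) simp
  have "length [] \<in> {length xs | xs. alg_indep A (map f xs)}"
    by (rule CollectI, rule exI[of _ "[]"]) simp
  then show "{length xs | xs. alg_indep A (map f xs)} \<noteq> {}" by blast
qed

lemma trdeg_ge: "is_subring A \<Longrightarrow> alg_indep A (map f xs) \<Longrightarrow> length xs \<le> trdeg A f"
  unfolding trdeg_def by (rule Max_ge) (auto simp: trdeg_set)

lemma trdeg_attained:
  assumes "is_subring A"
  obtains xs where "alg_indep A (map f xs)" "length xs = trdeg A f"
  using Max_in[OF trdeg_set[OF assms, of f]] unfolding trdeg_def by auto

text \<open>A longest independent family of images pulls back to an independent family, and \<tau>
  is injective on the ring \<open>B\<close> that this family generates. If the rank did not drop,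
  the family would be of maximal length in the source too, every entry would be algebraic over
  \<open>B\<close>, and the kernel element b would have a nonzero multiple in \<open>B\<close>,
  which \<tau> also kills.\<close>

lemma trdeg_drop:
  fixes f :: "'i::finite \<Rightarrow> 'r::idom" and \<tau> :: "'r \<Rightarrow> 's::idom"
  assumes \<tau>: "hom_on S \<tau>" and S: "is_subring S" and A: "is_subring A" "A \<subseteq> S"
    and f: "range f \<subseteq> S"
    and inj: "\<forall>x\<in>A. \<tau> x = 0 \<longrightarrow> x = 0"
    and b: "b \<in> adjoin_list A (map f es)" "b \<noteq> 0" "\<tau> b = 0"
  shows "trdeg (\<tau> ` A) (\<tau> \<circ> f) < trdeg A f"
proof (rule ccontr)
  assume not: "\<not> ?thesis"
  have \<tau>A: "is_subring (\<tau> ` A)"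
    using hom_image_subring[OF hom_on_subset[OF \<tau> A(2)] A(1)] .
  obtain xs where xs: "alg_indep (\<tau> ` A) (map (\<tau> \<circ> f) xs)" "length xs = trdeg (\<tau> ` A) (\<tau> \<circ> f)"
    by (rule trdeg_attained[OF \<tau>A])
  define B where "B = adjoin_list A (map f xs)"
  have "set (map f xs) \<subseteq> S" "alg_indep (\<tau> ` A) (map \<tau> (map f xs))" using f xs by auto
  from alg_indep_pullback[OF \<tau> S A this(1) inj this(2)]
  have ind: "alg_indep A (map f xs)" and B0: "\<forall>x\<in>B. \<tau> x = 0 \<longrightarrow> x = 0"
    by (auto simp: B_def)
  have B: "is_subring B" "A \<subseteq> B" "B \<subseteq> S"
    using is_subring_adjoin_list[OF A(1)] adjoin_list_base[OF A(1)] adjoin_list_least[OF S A(2)] f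
    by (auto simp: B_def image_subset_iff)
  have "\<not> transcendental B (f i)" for i
  proof
    assume "transcendental B (f i)"
    then have "alg_indep A (map f (xs @ [i]))"
      using ind by (simp add: alg_indep_append B_def)
    from trdeg_ge[OF A(1) this] show False using xs not by simp
  qed
  moreover have bB: "b \<in> adjoin_list B (map f es)"
  proof -
    have "adjoin_list A (map f es) \<subseteq> adjoin_list B (map f es)"
      by (rule adjoin_list_least) (use is_subring_adjoin_list[OF B(1)] adjoin_list_base[OF B(1)] B
        adjoin_list_gen[OF B(1)] in blast)+
    then show ?thesis using b by blast
  qed
  ultimately obtain u where u: "u \<in> adjoin_list B (map f es)" "u * b \<in> B" "u * b \<noteq> 0"
    using algebraic_multiple_list[OF B(1) _ bB b(2)] by auto
  have "adjoin_list B (map f es) \<subseteq> S" by (rule adjoin_list_least[OF S B(3)]) (use f in auto)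
  then have "\<tau> (u * b) = 0" using hom_on_mult[OF \<tau>, of u b] u bB b by auto
  then show False using B0 u by blast
qed

subsection \<open>Taylor series\<close>

text \<open>This turns a homomorphism that ignores derivatives into one that respects them: \<phi>
  becomes the constant term, and D becomes d/dt.\<close>

definition taylor :: "('r \<Rightarrow> 'r) \<Rightarrow> ('r \<Rightarrow> 'k::field_char_0) \<Rightarrow> 'r \<Rightarrow> 'k fps"
  where "taylor D \<phi> s = Abs_fps (\<lambda>n. \<phi> ((D ^^ n) s) / fact n)"

lemma taylor_nth_0 [simp]: "fps_nth (taylor D \<phi> s) 0 = \<phi> s"
  by (simp add: taylor_def)

lemma fps_deriv_taylor:
  fixes \<phi> :: "'r \<Rightarrow> 'k::field_char_0"
  shows "fps_deriv (taylor D \<phi> s) = taylor D \<phi> (D s)"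
proof (rule fps_ext)
  fix n
  have "(1 + of_nat n :: 'k) \<noteq> 0" by (metis of_nat_Suc of_nat_eq_0_iff nat.distinct(1))
  then show "fps_nth (fps_deriv (taylor D \<phi> s)) n = fps_nth (taylor D \<phi> (D s)) n"
    by (simp add: taylor_def funpow_swap1)
qed

lemma taylor_hom:
  fixes D :: "'r::comm_ring_1 \<Rightarrow> 'r" and \<phi> :: "'r \<Rightarrow> 'k::field_char_0"
  assumes S: "is_subring S" and \<phi>: "hom_on S \<phi>" and DS: "\<And>x. x \<in> S \<Longrightarrow> D x \<in> S"
    and Da: "\<And>x y. x \<in> S \<Longrightarrow> y \<in> S \<Longrightarrow> D (x + y) = D x + D y"
    and Dm: "\<And>x y. x \<in> S \<Longrightarrow> y \<in> S \<Longrightarrow> D (x * y) = D x * y + x * D y"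
  shows "hom_on S (taylor D \<phi>)"
  unfolding hom_on_def
proof (intro conjI ballI)
  note [simp] = is_subring_1[OF S] is_subring_0[OF S] is_subring_add[OF S] is_subring_mult[OF S] DS
  have Dn: "x \<in> S \<Longrightarrow> (D ^^ n) x \<in> S" for n x by (induction n) auto
  have D0: "D 0 = 0" using Da[of 0 0] by simp
  have D1: "D 1 = 0" using Dm[of 1 1] by simp
  have Dn0: "(D ^^ n) 0 = 0" for n by (induction n) (auto simp: D0)
  have Dn1: "(D ^^ Suc n) 1 = 0" for n by (simp only: funpow_Suc_right o_apply D1 Dn0)
  show "taylor D \<phi> 1 = 1"
  proof (rule fps_ext)
    fix n show "fps_nth (taylor D \<phi> 1) n = fps_nth 1 n"
      using Dn1 hom_on_1[OF \<phi>] hom_on_0[OF \<phi> S] by (cases n) (auto simp: taylor_def)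
  qed
  have Dna: "(D ^^ n) (x + y) = (D ^^ n) x + (D ^^ n) y" if "x \<in> S" "y \<in> S" for n x y
    using that by (induction n) (auto simp: Da Dn)
  show add: "taylor D \<phi> (x + y) = taylor D \<phi> x + taylor D \<phi> y" if "x \<in> S" "y \<in> S" for x y
    using that by (intro fps_ext) (simp add: taylor_def Dna hom_on_add[OF \<phi>] Dn add_divide_distrib)
  txt \<open>Comparing derivatives gives the next coefficient, so no Leibniz formula is needed.\<close>
  have "\<forall>x\<in>S. \<forall>y\<in>S. fps_nth (taylor D \<phi> (x * y)) n = fps_nth (taylor D \<phi> x * taylor D \<phi> y) n" for n
  proof (induction n)
    case 0
    then show ?case by (simp add: hom_on_mult[OF \<phi>])
  next
    case (Suc n)
    show ?case
    proof (intro ballI)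
      fix x y assume xy: "x \<in> S" "y \<in> S"
      have "of_nat (Suc n) * fps_nth (taylor D \<phi> (x * y)) (Suc n)
          = fps_nth (fps_deriv (taylor D \<phi> (x * y))) n"
        by simp
      also have "\<dots> = fps_nth (taylor D \<phi> (D x * y) + taylor D \<phi> (x * D y)) n"
        using xy by (simp only: fps_deriv_taylor Dm add DS is_subring_mult[OF S])
      also have "\<dots> = fps_nth (taylor D \<phi> (D x) * taylor D \<phi> y + taylor D \<phi> x * taylor D \<phi> (D y)) n"
        using Suc.IH xy by simp
      also have "\<dots> = fps_nth (fps_deriv (taylor D \<phi> x * taylor D \<phi> y)) n"
        by (simp add: fps_deriv_taylor[symmetric] add.commute)
      also have "\<dots> = of_nat (Suc n) * fps_nth (taylor D \<phi> x * taylor D \<phi> y) (Suc n)"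
        by (simp only: fps_deriv_nth Suc_eq_plus1)
      finally show "fps_nth (taylor D \<phi> (x * y)) (Suc n)
          = fps_nth (taylor D \<phi> x * taylor D \<phi> y) (Suc n)"
        by (metis mult_left_cancel nat.distinct(1) of_nat_eq_0_iff)
    qed
  qed
  then show "taylor D \<phi> (x * y) = taylor D \<phi> x * taylor D \<phi> y" if "x \<in> S" "y \<in> S" for x y
    using that by (intro fps_ext) auto
qed

lemma hom_on_det:
  fixes M :: "'r::comm_ring_1 ^ 'n::finite ^ 'n"
  assumes \<phi>: "hom_on S \<phi>" and S: "is_subring S" and M: "\<And>i j. M $ i $ j \<in> S"
  shows "\<phi> (det M) = det (map_matrix \<phi> M)" "det M \<in> S"
proof -
  have 1: "(\<Prod>i\<in>UNIV. M $ i $ p i) \<in> S" for p by (intro is_subring_prod[OF S] M)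
  then have 2: "of_int (sign p) * (\<Prod>i\<in>UNIV. M $ i $ p i) \<in> S" for p
    by (intro is_subring_mult[OF S] is_subring_of_int[OF S])
  then show "det M \<in> S" unfolding det_def by (intro is_subring_sum[OF S])
  show "\<phi> (det M) = det (map_matrix \<phi> M)"
    unfolding det_def map_matrix_def using M
    by (simp add: hom_on_sum[OF \<phi> S 2] hom_on_mult[OF \<phi> is_subring_of_int[OF S] 1]
      hom_on_of_int[OF \<phi> S]
        hom_on_prod[OF \<phi> S])
qed

subsection \<open>Derivations\<close>

text \<open>Stated for commutative rings, because the derivation is also extended to the polynomial
  ring K[\<lambda>,\<mu>].\<close>

definition derivation :: "('r::comm_ring_1 \<Rightarrow> 'r) \<Rightarrow> bool"
  where "derivation \<delta> \<longleftrightarrow> (\<forall>x y. \<delta> (x + y) = \<delta> x + \<delta> y \<and> \<delta> (x * y) = \<delta> x * y + x * \<delta> y)"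

lemma
  assumes "derivation \<delta>"
  shows deriv_add: "\<delta> (x + y) = \<delta> x + \<delta> y"
    and deriv_mult: "\<delta> (x * y) = \<delta> x * y + x * \<delta> y"
    and deriv_0: "\<delta> 0 = 0"
    and deriv_1: "\<delta> 1 = 0"
    and deriv_uminus: "\<delta> (- x) = - \<delta> x"
    and deriv_diff: "\<delta> (x - y) = \<delta> x - \<delta> y"
    and deriv_sum: "\<delta> (sum f I) = (\<Sum>i\<in>I. \<delta> (f i))"
    and deriv_of_int: "\<delta> (of_int k) = 0"
proof -
  show a: "\<delta> (x + y) = \<delta> x + \<delta> y" and m: "\<delta> (x * y) = \<delta> x * y + x * \<delta> y" for x y
    using assms by (auto simp: derivation_def)
  show 0: "\<delta> 0 = 0" using a[of 0 0] by (metis add_0 add_cancel_right_right)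
  show 1: "\<delta> 1 = 0" using m[of 1 1] by (metis add_cancel_right_right mult_1 mult_1_right)
  show u: "\<delta> (- x) = - \<delta> x" for x using a[of x "- x"] 0 add_eq_0_iff by fastforce
  show D: "\<delta> (x - y) = \<delta> x - \<delta> y" for x y using a[of x "- y"] u by simp
  show "\<delta> (sum f I) = (\<Sum>i\<in>I. \<delta> (f i))"
    by (induction I rule: infinite_finite_induct) (auto simp: 0 a)
  show "\<delta> (of_int k) = 0"
    by (induction k rule: int_induct[where k = 0]) (auto simp: 0 1 a D)
qed

subsection \<open>Embedding a differential field into power series\<close>

context field_derivation
begin

lemma derivation_d: "derivation d"
  by (simp add: derivation_def d_add d_mult)

lemmas d_0 = deriv_0[OF derivation_d]
  and d_1 = deriv_1[OF derivation_d]
  and d_uminus = deriv_uminus[OF derivation_d]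
  and d_sum = deriv_sum[OF derivation_d]

lemma d_of_nat: "d (of_nat n) = 0"
  by (induction n) (auto simp: d_0 d_1 d_add)

end

locale field_derivation_0 = field_derivation d for d :: "'a::field_char_0 \<Rightarrow> 'a"
begin

definition temb :: "'a \<Rightarrow> 'a alg_closure fps"
  where "temb = taylor d to_ac"

definition K :: "'a alg_closure fps set"
  where "K = range temb"

lemma temb_hom: "hom_on UNIV temb"
  unfolding temb_def
  by (rule taylor_hom) (auto simp: is_subring_def hom_on_def d_add d_mult)

lemma UNIV_subring: "is_subring UNIV"
  by (simp add: is_subring_def)

lemma temb_simps [simp]:
    "temb 0 = 0" "temb 1 = 1" "temb (x + y) = temb x + temb y" "temb (x * y) = temb x * temb y"
    "temb (x - y) = temb x - temb y" "temb (- x) = - temb x"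
  by (simp_all add: hom_on_0[OF temb_hom UNIV_subring] hom_on_1[OF temb_hom] hom_on_add[OF temb_hom]
      hom_on_mult[OF temb_hom] hom_on_diff[OF temb_hom UNIV_subring]
        hom_on_uminus[OF temb_hom UNIV_subring])

lemma temb_nth_0 [simp]: "fps_nth (temb x) 0 = to_ac x"
  by (simp add: temb_def)

lemma temb_eq_iff [simp]: "temb x = temb y \<longleftrightarrow> x = y"
  by (metis temb_nth_0 to_ac_eq_iff)

lemma temb_eq_0_iff [simp]: "temb x = 0 \<longleftrightarrow> x = 0"
  using temb_eq_iff[of x 0] by simp

lemma deriv_temb [simp]: "fps_deriv (temb x) = temb (d x)"
  by (simp add: temb_def fps_deriv_taylor)

lemma deriv_temb_pow: "(fps_deriv ^^ n) (temb x) = temb ((d ^^ n) x)"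
  by (induction n) auto

lemma temb_const: "d x = 0 \<Longrightarrow> temb x = fps_const (to_ac x)"
proof (rule fps_ext)
  fix n assume "d x = 0"
  have 0: "(d ^^ n) 0 = 0" for n by (induction n) (auto simp: d_0)
  show "fps_nth (temb x) n = fps_nth (fps_const (to_ac x)) n"
    using \<open>d x = 0\<close> 0 by (cases n) (auto simp: temb_def taylor_def funpow_swap1)
qed

lemma K_subring: "is_subring K"
  unfolding K_def by (rule hom_image_subring[OF temb_hom UNIV_subring])

lemma infinite_constants: "infinite (constants d)"
proof -
  have "range (of_nat :: nat \<Rightarrow> 'a) \<subseteq> constants d"
    by (auto simp: constants_def d_of_nat)
  then show ?thesis using infinite_super[OF _ range_inj_infinite[OF inj_of_nat]] by blast
qed

text \<open>Indexing the entries by pairs makes the matrix a finite family to which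
  \<open>trdeg\<close> applies. The determinant need only be nonzero, not a unit, since fractions
  are formed later.\<close>

definition solution :: "'a ^ 'l::finite ^ 'l \<Rightarrow> ('l \<times> 'l \<Rightarrow> 'a alg_closure fps) \<Rightarrow> bool"
  where "solution N f \<longleftrightarrow> det (\<chi> i j. f (i, j)) \<noteq> 0 \<and>
    (\<forall>i j. fps_deriv (f (i, j)) = (\<Sum>k\<in>UNIV. temb (N $ i $ k) * f (k, j)))"

text \<open>Comparing coefficients of t^n in Y' = N Y gives (n + 1) Y_(n+1) = \<Sum> N_m Y_(n-m);
  the initial value is the identity.\<close>

fun sol_coeff :: "'a ^ 'l::finite ^ 'l \<Rightarrow> nat \<Rightarrow> 'a alg_closure ^ 'l ^ 'l"
  where
    "sol_coeff N 0 = mat 1"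
  | "sol_coeff N (Suc n) = (\<chi> i j. (\<Sum>k\<in>UNIV. \<Sum>m\<in>{0..n}.
       fps_nth (temb (N $ i $ k)) m * sol_coeff N (n - m) $ k $ j) / of_nat (Suc n))"

lemma solution_ex: "\<exists>f. solution (N :: 'a ^ 'l::finite ^ 'l) f"
proof
  define f where "f = (\<lambda>(i, j). Abs_fps (\<lambda>n. sol_coeff N n $ i $ j))"
  let ?F = "(\<chi> i j. f (i, j)) :: 'a alg_closure fps ^ 'l ^ 'l"
  have h: "hom_on UNIV (\<lambda>s :: 'a alg_closure fps. fps_nth s 0)"
    by (simp add: hom_on_def)
  have "map_matrix (\<lambda>s. fps_nth s 0) ?F = mat 1"
    by (simp add: map_matrix_def f_def mat_def vec_eq_iff)
  then have "fps_nth (det ?F) 0 = 1"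
    using hom_on_det(1)[OF h UNIV_subring, of ?F] by simp
  then have "det ?F \<noteq> 0" by auto
  moreover have "fps_deriv (f (i, j)) = (\<Sum>k\<in>UNIV. temb (N $ i $ k) * f (k, j))" for i j
  proof (rule fps_ext)
    fix n
    have nz: "(1 + of_nat n :: 'a alg_closure) \<noteq> 0"
      by (metis of_nat_Suc of_nat_eq_0_iff nat.distinct(1))
    then show "fps_nth (fps_deriv (f (i, j))) n = fps_nth (\<Sum>k\<in>UNIV. temb (N $ i $ k) * f (k, j)) n"
      by (simp add: f_def fps_sum_nth fps_mult_nth)
  qed
  ultimately show "solution N f" by (simp add: solution_def)
qed

text \<open>Differentiating the coefficients of the monic minimal polynomial of c gives a polynomial
  of smaller degree that still vanishes at c, hence 0. So the coefficients lie in C, which is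
  algebraically closed and therefore contains c.\<close>

lemma algebraic_constant:
  assumes ac: "constants_alg_closed d" and alg: "\<not> transcendental K (fps_const c)"
  shows "c \<in> to_ac ` constants d"
proof -
  define Z where "Z q = poly (map_poly temb q) (fps_const c)" for q
  have mp: "map_poly temb (p + q) = map_poly temb p + map_poly temb q"
    "map_poly temb (p * q) = map_poly temb p * map_poly temb q"
    "map_poly temb (smult a q) = smult (temb a) (map_poly temb q)" for p q a
    using map_poly_add_on[OF temb_hom UNIV_subring, of p q]
      map_poly_mult_on[OF temb_hom UNIV_subring, of p q]
      map_poly_smult_on[OF temb_hom UNIV_subring, of q q a]
    by (simp_all add: poly_over_def)
  have Z: "Z (p * q) = Z p * Z q" "Z (smult a q) = temb a * Z q" for p q a
    by (simp_all add: Z_def mp)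
  have "\<exists>q. q \<noteq> 0 \<and> Z q = 0"
  proof -
    obtain p where p: "p \<in> poly_over K" "poly p (fps_const c) = 0" "p \<noteq> 0"
      using alg by (auto simp: transcendental_def)
    define q where "q = map_poly (inv_into UNIV temb) p"
    have "inv_into UNIV temb 0 = 0" by (metis temb_eq_iff temb_simps(1) inv_f_f injI)
    then have "map_poly temb q = p"
      using p(1) by (intro poly_eqI)
        (auto simp: coeff_map_poly q_def poly_over_def K_def f_inv_into_f)
    then show ?thesis using p by (intro exI[of _ q]) (auto simp: Z_def)
  qed
  from ex_has_least_nat[of "\<lambda>q. q \<noteq> 0 \<and> Z q = 0" _ degree] this
  obtain q0 where q0: "q0 \<noteq> 0" "Z q0 = 0" and min0: "\<And>r. r \<noteq> 0 \<Longrightarrow> Z r = 0 \<Longrightarrow> degree q0 \<le> degree r"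
    by metis
  \<comment> \<open>Made monic, so that the leading coefficient has derivative 0 and the degree
    drops.\<close>
  define q where "q = smult (inverse (lead_coeff q0)) q0"
  have q: "q \<noteq> 0" "Z q = 0" "lead_coeff q = 1" and min: "\<And>r. Z r = 0 \<Longrightarrow> degree r < degree q \<Longrightarrow> r = 0"
    using q0 min0 by (auto simp: q_def Z) (meson leD)
  have deg: "degree q > 0"
  proof (rule gr0I)
    assume "degree q = 0"
    then obtain a where "q = [:a:]" by (auto elim: degree_eq_zeroE)
    then show False using q by (simp add: Z_def map_poly_pCons)
  qed
  have cd: "coeff (map_poly d p) i = d (coeff p i)" for p i
    by (simp add: coeff_map_poly d_0)
  \<comment> \<open>As \<open>fps_const c\<close> has derivative 0, only the coefficients of p are
    differentiated.\<close>
  have "fps_deriv (Z p) = Z (map_poly d p)" for p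
    by (induction p) (simp_all add: Z_def map_poly_pCons d_0)
  then have "Z (map_poly d q) = 0" using q(2) by (metis fps_deriv_0)
  moreover have "degree (map_poly d q) < degree q"
  proof -
    have "coeff (map_poly d q) i = 0" if "i > degree q - 1" for i
      using that q(3) by (cases "i = degree q") (auto simp: cd d_1 d_0 coeff_eq_0)
    then have "degree (map_poly d q) \<le> degree q - 1" by (intro degree_le) auto
    then show ?thesis using deg by linarith
  qed
  ultimately have "map_poly d q = 0" using min by blast
  then have "d (coeff q i) = 0" for i using cd[of q i] by simp
  then have "range (coeff q) \<subseteq> constants d" by (auto simp: constants_def)
  then obtain g where g: "g \<in> constants d" "poly q g = 0"
    using ac deg unfolding constants_alg_closed_def by (metis One_nat_def Suc_leI)
  \<comment> \<open>The cofactor of the linear factor has smaller degree, so it cannot vanish at c;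
    hence the linear factor does.\<close>
  then obtain r where r: "q = [:- g, 1:] * r" by (auto simp: poly_eq_0_iff_dvd dvd_def)
  have "r \<noteq> 0" using q r by auto
  then have "degree r < degree q" by (simp add: r degree_mult_eq del: mult_pCons_left)
  then have "Z r \<noteq> 0" using min \<open>r \<noteq> 0\<close> by blast
  moreover have "Z q = (fps_const c - temb g) * Z r"
    unfolding r Z by (simp add: Z_def map_poly_pCons)
  ultimately have "fps_const c = temb g" using q by simp
  then have "c = to_ac g" by (metis fps_nth_fps_const temb_nth_0)
  then show ?thesis using g by blast
qed

text \<open>The fraction c = x / y is written as a product, which keeps the argument inside power
  series. In the ring S = K[c][f] the constant c is adjoined before the entries of f: its value is
  prescribed first, and suitable values for the entries are then found.\<close>

lemma no_new_constants:
  fixes N :: "'a ^ 'l::finite ^ 'l"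
  assumes ac: "constants_alg_closed d"
    and f: "solution N f" and min: "\<And>g. solution N g \<Longrightarrow> trdeg K f \<le> trdeg K g"
    and es: "set es = (UNIV :: ('l \<times> 'l) set)"
    and xy: "x \<in> adjoin_list K (map f es)" "y \<in> adjoin_list K (map f es)" "y \<noteq> 0" "fps_const c * y
      = x"
  shows "c \<in> to_ac ` constants d"
proof (rule ccontr)
  assume nc: "c \<notin> to_ac ` constants d"
  then have tr: "transcendental K (fps_const c)" using algebraic_constant[OF ac] by blast
  define A where "A = adjoin K (fps_const c)"
  have A: "is_subring A" "K \<subseteq> A" "fps_const c \<in> A"
    unfolding A_def using is_subring_adjoin[OF K_subring] adjoin_base[OF K_subring]
      adjoin_gen[OF K_subring]
    by auto
  define S where "S = adjoin_list A (map f es)"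
  have S: "is_subring S" "A \<subseteq> S" "range f \<subseteq> S"
    unfolding S_def using is_subring_adjoin_list[OF A(1)] adjoin_list_base[OF A(1)]
      adjoin_list_gen[OF A(1), of "map f es"] es
    by auto
  have KS: "K \<subseteq> S" "adjoin_list K (map f es) \<subseteq> S"
    using A S by (blast, intro adjoin_list_least S(1)) auto
  have fij: "f (i, j) \<in> S" for i j using S(3) by blast
  \<comment> \<open>The elements of S whose derivative lies in S form a subring containing K, c and,
    by the differential system, the entries of f.\<close>
  have DS: "fps_deriv s \<in> S" if "s \<in> S" for s
  proof -
    define T where "T = {s \<in> S. fps_deriv s \<in> S}"
    have T: "is_subring T"
      using is_subring_1[OF S(1)] is_subring_0[OF S(1)] is_subring_diff[OF S(1)]
        is_subring_mult[OF S(1)] is_subring_add[OF S(1)]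
      by (auto simp: is_subring_def T_def)
    have "K \<subseteq> T"
      using KS(1) by (auto simp: K_def T_def)
    moreover have "fps_const c \<in> T"
      using A S is_subring_0[OF S(1)] by (auto simp: T_def)
    ultimately have AT: "A \<subseteq> T" unfolding A_def by (intro adjoin_least T)
    have fp: "fps_deriv (f (i, j)) = (\<Sum>k\<in>UNIV. temb (N $ i $ k) * f (k, j))" for i j
      using f by (simp add: solution_def)
    have "temb a \<in> S" for a using KS(1) by (auto simp: K_def)
    then have "fps_deriv (f (i, j)) \<in> S" for i j
      unfolding fp by (intro is_subring_sum[OF S(1)] is_subring_mult[OF S(1)] fij)
    then have "set (map f es) \<subseteq> T" using fij by (auto simp: T_def)
    then have "S \<subseteq> T" unfolding S_def by (intro adjoin_list_least T AT)
    then show ?thesis using that by (auto simp: T_def)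
  qed
  define b where "b = det (\<chi> i j. f (i, j))"
  have "hom_on S (\<lambda>x. x)" by (simp add: hom_on_def)
  from hom_on_det(2)[OF this S(1), of "\<chi> i j. f (i, j)"] fij have bS: "b \<in> S" by (simp add: b_def)
  have "b \<noteq> 0" using f by (simp add: solution_def b_def)
  from hom_extend_nonzero_list[where 'k = "'a alg_closure", OF A(1) bS[unfolded S_def] this]
  obtain a where a: "a \<in> A" "a \<noteq> 0" and ext: "\<And>\<phi> :: 'a alg_closure fps \<Rightarrow> 'a alg_closure.
      hom_on A \<phi> \<Longrightarrow> \<phi> a \<noteq> 0 \<Longrightarrow> \<exists>\<psi>. hom_on S \<psi> \<and> (\<forall>a\<in>A. \<psi> a = \<phi> a) \<and> \<psi> b \<noteq> 0"
    unfolding S_def by blast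
  obtain p where p: "p \<in> poly_over K" "a = poly p (fps_const c)"
    using a(1) by (auto simp: A_def elim: adjoinE)
  let ?at0 = "\<lambda>s :: 'a alg_closure fps. fps_nth s 0"
  have at0: "hom_on K ?at0" by (simp add: hom_on_def)
  \<comment> \<open>Taking the constant term is injective on K, so p keeps a nonzero coefficient and
    only finitely many values for c would kill a.\<close>
  have "map_poly ?at0 p \<noteq> 0"
  proof
    assume "map_poly ?at0 p = 0"
    then have "fps_nth (coeff p i) 0 = 0" for i
      using coeff_map_hom[OF at0 K_subring, of p i] by simp
    moreover have "\<exists>u. coeff p i = temb u" for i
      using p(1) by (auto simp: poly_over_def K_def)
    ultimately have "coeff p i = 0" for i
      by (metis temb_nth_0 temb_simps(1) to_ac_eq_0_iff)
    then have "p = 0" by (simp add: poly_eq_iff)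
    then show False using p a by simp
  qed
  moreover have "infinite (to_ac ` constants d)"
    using infinite_constants finite_imageD[OF _ inj_on_subset[OF inj_to_ac subset_UNIV]] by blast
  ultimately have "\<exists>w\<in>to_ac ` constants d. poly (map_poly ?at0 p) w \<noteq> 0"
    by (rule non_root_ex)
  then obtain g where g: "g \<in> constants d" "poly (map_poly ?at0 p) (to_ac g) \<noteq> 0"
    by blast
  \<comment> \<open>Since c satisfies no nontrivial relation over K, its value can be prescribed
    freely.\<close>
  have "poly (map_poly ?at0 q) (to_ac g) = 0" if "q \<in> poly_over K" "poly q (fps_const c) = 0" for q
    using that tr by (auto simp: transcendental_def)
  from hom_extend[OF K_subring at0 this] obtain \<phi>0 where \<phi>0: "hom_on A \<phi>0"
    "\<And>a. a \<in> K \<Longrightarrow> \<phi>0 a = fps_nth a 0"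
    "\<And>q. q \<in> poly_over K \<Longrightarrow> \<phi>0 (poly q (fps_const c)) = poly (map_poly ?at0 q) (to_ac g)"
    unfolding A_def by blast
  have "\<phi>0 a \<noteq> 0" using \<phi>0(3)[OF p(1)] g p by simp
  from ext[OF \<phi>0(1) this] obtain \<phi> where \<phi>: "hom_on S \<phi>" "\<And>a. a \<in> A \<Longrightarrow> \<phi> a = \<phi>0 a" "\<phi> b \<noteq> 0"
    by blast
  have \<phi>temb: "\<phi> (temb a) = to_ac a" for a
    using \<phi>(2)[of "temb a"] \<phi>0(2)[of "temb a"] A(2) by (auto simp: K_def)
  have "[:0, 1:] \<in> poly_over K"
    by (intro poly_over_pCons[OF K_subring] is_subring_0[OF K_subring] is_subring_1[OF K_subring]
      poly_over_0[OF K_subring])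
  from \<phi>0(3)[OF this] have \<phi>c: "\<phi> (fps_const c) = to_ac g"
    using \<phi>(2)[OF A(3)] by (simp add: map_poly_pCons)
  \<comment> \<open>The constant term of \<tau> b is \<phi> b, so the determinant stays nonzero when
    the solution is mapped by \<tau>.\<close>
  define \<tau> where "\<tau> = taylor fps_deriv \<phi>"
  have \<tau>: "hom_on S \<tau>"
    unfolding \<tau>_def by (rule taylor_hom[OF S(1) \<phi>(1) DS]) (simp_all add: add.commute)
  have \<tau>temb: "\<tau> (temb a) = temb a" for a
    unfolding \<tau>_def taylor_def deriv_temb_pow \<phi>temb by (simp add: temb_def taylor_def)
  \<comment> \<open>Both c and g are constants, so each Taylor series consists of its constant term
    alone.\<close>
  have \<tau>c: "\<tau> (fps_const c) = temb g"
  proof (rule fps_ext)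
    fix n
    have 0: "(fps_deriv ^^ n) 0 = (0 :: 'a alg_closure fps)" for n by (induction n) auto
    show "fps_nth (\<tau> (fps_const c)) n = fps_nth (temb g) n"
      using g(1) \<phi>c hom_on_0[OF \<phi>(1) S(1)] temb_const[of g] 0
      by (cases n) (auto simp: \<tau>_def taylor_def funpow_swap1 constants_def)
  qed
  have "solution N (\<tau> \<circ> f)"
    unfolding solution_def
  proof (intro conjI allI)
    have "map_matrix \<tau> (\<chi> i j. f (i, j)) = (\<chi> i j. (\<tau> \<circ> f) (i, j))"
      by (simp add: map_matrix_def)
    then have "det (\<chi> i j. (\<tau> \<circ> f) (i, j)) = \<tau> b"
      using hom_on_det(1)[OF \<tau> S(1), of "\<chi> i j. f (i, j)"] fij by (simp add: b_def)
    moreover have "fps_nth (\<tau> b) 0 \<noteq> 0" using \<phi>(3) by (simp add: \<tau>_def)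
    ultimately show "det (\<chi> i j. (\<tau> \<circ> f) (i, j)) \<noteq> 0" by auto
    fix i j
    have mem: "temb (N $ i $ k) * f (k, j) \<in> S" "temb (N $ i $ k) \<in> S" for k
      using KS(1) by (auto simp: K_def intro!: is_subring_mult[OF S(1)] fij)
    have "fps_deriv ((\<tau> \<circ> f) (i, j)) = \<tau> (fps_deriv (f (i, j)))"
      by (simp add: \<tau>_def fps_deriv_taylor)
    also have "\<dots> = \<tau> (\<Sum>k\<in>UNIV. temb (N $ i $ k) * f (k, j))"
      using f by (simp add: solution_def)
    also have "\<dots> = (\<Sum>k\<in>UNIV. temb (N $ i $ k) * (\<tau> \<circ> f) (k, j))"
      by (simp add: hom_on_sum[OF \<tau> S(1)] mem hom_on_mult[OF \<tau>] fij \<tau>temb)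
    finally show "fps_deriv ((\<tau> \<circ> f) (i, j)) = (\<Sum>k\<in>UNIV. temb (N $ i $ k) * (\<tau> \<circ> f) (k, j))" .
  qed
  from min[OF this] have "trdeg K f \<le> trdeg K (\<tau> \<circ> f)" .
  moreover have "\<tau> ` K = K" by (auto simp: K_def \<tau>temb image_iff)
  moreover have "trdeg (\<tau> ` K) (\<tau> \<circ> f) < trdeg K f"
  proof (rule trdeg_drop[OF \<tau> S(1) K_subring KS(1) S(3)])
    show "\<forall>x\<in>K. \<tau> x = 0 \<longrightarrow> x = 0" by (auto simp: K_def \<tau>temb)
    have g': "temb g = fps_const (to_ac g)" using g by (intro temb_const) (simp add: constants_def)
    \<comment> \<open>The kernel element is (c - g) y. Written as x - g y it is seen to lie in K[f],
      as \<open>trdeg_drop\<close> requires, although c itself need not.\<close>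
    have "temb g * y \<in> adjoin_list K (map f es)"
      using adjoin_list_base[OF K_subring] xy(2)
      by (intro is_subring_mult[OF is_subring_adjoin_list[OF K_subring]]) (auto simp: K_def)
    then show "x - temb g * y \<in> adjoin_list K (map f es)"
      by (intro is_subring_diff[OF is_subring_adjoin_list[OF K_subring]] xy)
    have "c \<noteq> to_ac g" using nc g by blast
    then have "fps_const c - temb g \<noteq> 0" unfolding g' by simp
    moreover have *: "x - temb g * y = (fps_const c - temb g) * y"
      using xy(4) by (simp add: algebra_simps)
    ultimately show "x - temb g * y \<noteq> 0" using xy(3) by simp
    have "fps_const c - temb g \<in> S" "y \<in> S" "temb g \<in> S" "fps_const c \<in> S"
      using A S KS xy(2) by (auto simp: K_def intro!: is_subring_diff[OF S(1)])
    then show "\<tau> (x - temb g * y) = 0"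
      unfolding * by (simp add: hom_on_mult[OF \<tau>] hom_on_diff[OF \<tau> S(1)] \<tau>c \<tau>temb)
  qed
  ultimately show False by simp
qed

end

subsection \<open>Generated subfields and their cardinality\<close>

inductive_set field_closure :: "'k::field set \<Rightarrow> 'k set" for G
  where
    fc_base: "x \<in> G \<Longrightarrow> x \<in> field_closure G"
  | fc_1: "1 \<in> field_closure G"
  | fc_add: "x \<in> field_closure G \<Longrightarrow> y \<in> field_closure G \<Longrightarrow> x + y \<in> field_closure G"
  | fc_uminus: "x \<in> field_closure G \<Longrightarrow> - x \<in> field_closure G"
  | fc_mult: "x \<in> field_closure G \<Longrightarrow> y \<in> field_closure G \<Longrightarrow> x * y \<in> field_closure G"
  | fc_inverse: "x \<in> field_closure G \<Longrightarrow> x \<noteq> 0 \<Longrightarrow> inverse x \<in> field_closure G"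

lemma field_closure_subring: "is_subring (field_closure G)"
  unfolding is_subring_def
  by (auto intro: fc_1 fc_mult) (metis fc_add fc_uminus diff_conv_add_uminus)

lemma field_closure_divide:
  assumes "x \<in> field_closure G" "y \<in> field_closure G"
  shows "x / y \<in> field_closure G"
  using assms is_subring_0[OF field_closure_subring, of G]
  by (cases "y = 0") (auto simp: divide_inverse intro: fc_mult fc_inverse)

text \<open>A countable exhaustion of the generated field by rounds of field operations, so that its
  size can be bounded one round at a time.\<close>

primrec fc_stage :: "'k::field set \<Rightarrow> nat \<Rightarrow> 'k set"
  where
    "fc_stage G 0 = G \<union> {1}"
  | "fc_stage G (Suc n) = fc_stage G n \<union> (uminus ` fc_stage G n \<union> (inverse ` fc_stage G n \<union>
      ((\<lambda>(x, y). x + y) ` (fc_stage G n \<times> fc_stage G n) \<union>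
       (\<lambda>(x, y). x * y) ` (fc_stage G n \<times> fc_stage G n))))"

lemma fc_stage_mono: "m \<le> n \<Longrightarrow> fc_stage G m \<subseteq> fc_stage G n"
  by (induction n rule: nat_induct_at_least[of m]) auto

lemma field_closure_stages: "field_closure G \<subseteq> (\<Union>n. fc_stage G n)"
proof
  fix x assume "x \<in> field_closure G"
  then have "\<exists>n. x \<in> fc_stage G n"
  proof induction
    case (fc_base x)
    then show ?case by (intro exI[of _ 0]) simp
  next
    case fc_1
    then show ?case by (intro exI[of _ 0]) simp
  next
    case (fc_add x y)
    then obtain m n where "x \<in> fc_stage G m" "y \<in> fc_stage G n" by blast
    then have "(x, y) \<in> fc_stage G (max m n) \<times> fc_stage G (max m n)"
      using fc_stage_mono[of m "max m n" G] fc_stage_mono[of n "max m n" G] by auto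
    then show ?case by (intro exI[of _ "Suc (max m n)"]) (auto simp: image_iff)
  next
    case (fc_mult x y)
    then obtain m n where "x \<in> fc_stage G m" "y \<in> fc_stage G n" by blast
    then have "(x, y) \<in> fc_stage G (max m n) \<times> fc_stage G (max m n)"
      using fc_stage_mono[of m "max m n" G] fc_stage_mono[of n "max m n" G] by auto
    then show ?case by (intro exI[of _ "Suc (max m n)"]) (auto simp: image_iff)
  next
    case (fc_uminus x)
    then obtain n where "x \<in> fc_stage G n" by blast
    then show ?case by (intro exI[of _ "Suc n"]) auto
  next
    case (fc_inverse x)
    then obtain n where "x \<in> fc_stage G n" by blast
    then show ?case by (intro exI[of _ "Suc n"]) auto
  qed
  then show "x \<in> (\<Union>n. fc_stage G n)" by blast
qed

text \<open>Unary and binary images and countable unions do not lead beyond an infinite cardinal.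
  This bound is what allows the extension to be moved into the type of the base field.\<close>

lemma field_closure_card:
  includes cardinal_syntax
  fixes G :: "'k::field set" and W :: "'c set"
  assumes W: "infinite W" and G: "|G| \<le>o |W|"
  shows "|field_closure G| \<le>o |W|"
proof -
  have un: "|S \<union> T| \<le>o |W|" if "|S| \<le>o |W|" "|T| \<le>o |W|" for S T :: "'k set"
    using card_of_Un_ordLeq_infinite_Field[OF _ that card_of_Card_order] W
      by (simp add: Field_card_of)
  have im: "|g ` S| \<le>o |W|" if "|S| \<le>o |W|" for g :: "'k \<Rightarrow> 'k" and S
    using ordLeq_transitive[OF card_of_image that] .
  have im2: "|g ` (S \<times> S)| \<le>o |W|" if "|S| \<le>o |W|" for g :: "'k \<times> 'k \<Rightarrow> 'k" and S
  proof -
    have "|S \<times> S| \<le>o |W|"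
      using card_of_Times_ordLeq_infinite_Field[OF _ that that card_of_Card_order] W
        by (simp add: Field_card_of)
    then show ?thesis by (rule ordLeq_transitive[OF card_of_image])
  qed
  have "|{1 :: 'k}| \<le>o |W|"
    using W by (intro card_of_singl_ordLeq) auto
  then have st: "|fc_stage G n| \<le>o |W|" for n
    by (induction n) (simp_all only: fc_stage.simps un im im2 G)
  have "|UNIV :: nat set| \<le>o |W|"
    using W infinite_iff_card_of_nat by blast
  then have "|\<Union>n. fc_stage G n| \<le>o |W|"
    using st by (intro card_of_UNION_ordLeq_infinite[OF W]) auto
  then show ?thesis
    using ordLeq_transitive[OF card_of_mono1[OF field_closure_stages]] by blast
qed

subsection \<open>Transport of a differential subfield along an injection\<close>

text \<open>The operations are pulled back along \<open>inv_into S h\<close>, so h has to be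
  injective only on the subfield S and not on the whole ambient field.\<close>

definition transport_ring :: "('k::field \<Rightarrow> 'c) \<Rightarrow> 'k set \<Rightarrow> 'c ring"
  where "transport_ring h S = \<lparr>carrier = h ` S,
    monoid.mult = (\<lambda>x y. h (inv_into S h x * inv_into S h y)), one = h 1,
    ring.zero = h 0, add = (\<lambda>x y. h (inv_into S h x + inv_into S h y))\<rparr>"

context
  fixes h :: "'k::field \<Rightarrow> 'c" and G S
  assumes h: "inj_on h S" and S: "S = field_closure G"
begin

lemma S_subring: "is_subring S"
  unfolding S by (rule field_closure_subring)

lemma transport_simps:
  "carrier (transport_ring h S) = h ` S" "\<one>\<^bsub>transport_ring h S\<^esub> = h 1" "\<zero>\<^bsub>transport_ring h S\<^esub> = h 0"
  "x \<in> S \<Longrightarrow> y \<in> S \<Longrightarrow> h x \<otimes>\<^bsub>transport_ring h S\<^esub> h y = h (x * y)"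
  "x \<in> S \<Longrightarrow> y \<in> S \<Longrightarrow> h x \<oplus>\<^bsub>transport_ring h S\<^esub> h y = h (x + y)"
  using h by (simp_all add: transport_ring_def)

lemma transport_field: "field (transport_ring h S)"
proof -
  let ?E = "transport_ring h S"
  note [simp] = is_subring_0[OF S_subring] is_subring_1[OF S_subring] is_subring_add[OF S_subring]
    is_subring_mult[OF S_subring]
    is_subring_uminus[OF S_subring]
  have "cring ?E"
  proof (rule cringI)
    show "abelian_group ?E"
    proof (rule abelian_groupI)
      show "\<exists>y\<in>carrier ?E. y \<oplus>\<^bsub>?E\<^esub> x = \<zero>\<^bsub>?E\<^esub>" if x: "x \<in> carrier ?E" for x
      proof -
        obtain a where "a \<in> S" "x = h a" using x by (auto simp: transport_simps)
        then show ?thesis by (intro bexI[of _ "h (- a)"]) (auto simp: transport_simps)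
      qed
    qed (auto simp: transport_simps algebra_simps)
    show "comm_monoid ?E"
      by (rule comm_monoidI) (auto simp: transport_simps algebra_simps)
  qed (auto simp: transport_simps algebra_simps)
  then show ?thesis
  proof (rule cring.cring_fieldI2)
    show "\<zero>\<^bsub>?E\<^esub> \<noteq> \<one>\<^bsub>?E\<^esub>" using h by (auto simp: transport_simps dest: inj_onD)
    fix x assume x: "x \<in> carrier ?E" "x \<noteq> \<zero>\<^bsub>?E\<^esub>"
    then obtain a where a: "a \<in> S" "x = h a" "a \<noteq> 0" by (auto simp: transport_simps)
    then have "inverse a \<in> S" unfolding S by (intro fc_inverse)
    then show "\<exists>y\<in>carrier ?E. x \<otimes>\<^bsub>?E\<^esub> y = \<one>\<^bsub>?E\<^esub>"
      using a by (intro bexI[of _ "h (inverse a)"]) (auto simp: transport_simps)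
  qed
qed

lemma transport_finsum:
  assumes "finite I" "\<And>i. i \<in> I \<Longrightarrow> f i \<in> S"
  shows "(\<Oplus>\<^bsub>transport_ring h S\<^esub>i\<in>I. h (f i)) = h (sum f I)"
proof -
  interpret E: field "transport_ring h S" by (rule transport_field)
  show ?thesis using assms
  proof (induction I rule: finite_induct)
    case empty
    then show ?case by (simp add: transport_simps)
  next
    case (insert i I)
    have "(\<lambda>i. h (f i)) \<in> I \<rightarrow> carrier (transport_ring h S)" "h (f i) \<in> carrier (transport_ring h S)"
      using insert.prems by (auto simp: transport_simps)
    then have "(\<Oplus>\<^bsub>transport_ring h S\<^esub>i\<in>insert i I. h (f i))
        = h (f i) \<oplus>\<^bsub>transport_ring h S\<^esub> (\<Oplus>\<^bsub>transport_ring h S\<^esub>i\<in>I. h (f i))"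
      using insert.hyps by (intro E.finsum_insert)
    then show ?case
      using insert by (simp add: transport_simps is_subring_sum[OF S_subring])
  qed
qed

lemma transport_generate:
  assumes "h ` G \<subseteq> U" "U \<subseteq> h ` S"
  shows "carrier (transport_ring h S) = generate_field (transport_ring h S) U"
proof
  let ?E = "transport_ring h S"
  interpret E: field ?E by (rule transport_field)
  show "generate_field ?E U \<subseteq> carrier ?E"
    using E.generate_field_incl assms by (simp add: transport_simps)
  have "h x \<in> generate_field ?E U" if "x \<in> field_closure G" for x
    using that
  proof induction
    case (fc_base x)
    then show ?case using assms by (auto intro: generate_field.incl)
  next
    case fc_1
    then show ?case using generate_field.one[of ?E] by (simp add: transport_simps)
  next
    case (fc_add x y)
    then show ?case
      using generate_field.eng_add[of "h x" ?E U "h y"] by (simp add: transport_simps flip: S)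
  next
    case (fc_mult x y)
    then show ?case
      using generate_field.eng_mult[of "h x" ?E U "h y"] by (simp add: transport_simps flip: S)
  next
    case (fc_uminus x)
    have "\<ominus>\<^bsub>?E\<^esub> h x = h (- x)"
      by (rule E.minus_equality)
        (use fc_uminus.hyps in \<open>auto simp: transport_simps
          is_subring_uminus[OF S_subring] simp flip: S\<close>)
    then show ?case using generate_field.a_inv[OF fc_uminus.IH] by simp
  next
    case (fc_inverse x)
    have i: "inverse x \<in> S" using fc_inverse.hyps unfolding S by (intro field_closure.fc_inverse)
    have "inv\<^bsub>?E\<^esub> h x = h (inverse x)"
      by (rule E.comm_inv_char) (use fc_inverse.hyps i in \<open>auto simp: transport_simps simp flip: S\<close>)
    moreover have "h x \<noteq> \<zero>\<^bsub>?E\<^esub>"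
      using fc_inverse.hyps h is_subring_0[OF S_subring]
        by (auto simp: transport_simps dest: inj_onD simp flip: S)
    ultimately show ?case using generate_field.m_inv[OF fc_inverse.IH] by simp
  qed
  then show "carrier ?E \<subseteq> generate_field ?E U" by (auto simp: transport_simps simp flip: S)
qed

end

lemma picard_vessiot_transport:
  fixes d :: "'a::field \<Rightarrow> 'a" and D :: "'k::field \<Rightarrow> 'k" and j :: "'a \<Rightarrow> 'k"
    and F :: "'k ^ 'l::finite ^ 'l" and h :: "'k \<Rightarrow> 'c"
  assumes d: "field_derivation d" and D: "field_derivation D"
    and j: "hom_on UNIV j" and Dj: "\<And>a. D (j a) = j (d a)"
    and S: "S = field_closure (range j \<union> {F $ i $ k | i k. True})"
    and DF: "\<And>i k. D (F $ i $ k) = (\<Sum>m\<in>UNIV. j (N $ i $ m) * F $ m $ k)" and F: "det F \<noteq> 0"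
    and const: "\<And>x. x \<in> S \<Longrightarrow> D x = 0 \<Longrightarrow> x \<in> j ` constants d"
    and h: "inj_on h S"
  shows "\<exists>(E :: 'c ring) \<delta> \<iota>. picard_vessiot d N E \<delta> \<iota>"
proof -
  define E where "E = transport_ring h S"
  define g where "g = inv_into S h"
  define \<delta> where "\<delta> = h \<circ> D \<circ> g"
  define \<iota> where "\<iota> = h \<circ> j"
  interpret d: field_derivation d by (rule d)
  interpret D: field_derivation D by (rule D)
  note ts = transport_simps[OF h S, folded E_def]
  note sum = transport_finsum[OF h S, folded E_def]
  interpret E: field E unfolding E_def by (rule transport_field[OF h S])
  have SS: "is_subring S" unfolding S by (rule field_closure_subring)
  have jS: "j a \<in> S" for a unfolding S by (intro fc_base) auto
  have FS: "F $ i $ k \<in> S" for i k unfolding S by (intro fc_base) auto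
  have gh: "g (h x) = x" if "x \<in> S" for x unfolding g_def using h that by simp
  note [simp] = jS FS is_subring_0[OF SS] is_subring_1[OF SS] is_subring_add[OF SS]
    is_subring_mult[OF SS] is_subring_diff[OF SS]
    is_subring_uminus[OF SS] gh
  have DS: "D x \<in> S" if "x \<in> S" for x
    using that unfolding S
  proof induction
    case (fc_base x)
    have "D x \<in> S" using fc_base by (auto simp: Dj DF intro!: is_subring_sum[OF SS])
    then show ?case by (simp add: S)
  next
    case fc_1
    then show ?case using is_subring_0[OF SS] by (simp add: D.d_1 S)
  next
    case (fc_inverse x)
    have "D x * inverse x + x * D (inverse x) = 0"
      using fc_inverse D.d_mult[of x "inverse x"] by (simp add: D.d_1)
    then have *: "x * D (inverse x) = - (D x * inverse x)"
      using add_eq_0_iff by blast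
    have "D (inverse x) = inverse x * x * D (inverse x)" using fc_inverse(2) by simp
    also have "\<dots> = inverse x * (- (D x * inverse x))" using * by (simp only: mult.assoc)
    also have "\<dots> = - (D x * inverse x * inverse x)" by (simp only: mult_minus_right mult.commute)
    finally have "D (inverse x) = - (D x * inverse x * inverse x)" .
    then show ?case
      using fc_inverse.IH field_closure.fc_inverse[OF fc_inverse.hyps]
      by (simp only: fc_uminus fc_mult)
  next
    case (fc_add x y)
    then show ?case by (simp add: D.d_add field_closure.fc_add)
  next
    case (fc_mult x y)
    then show ?case by (simp add: D.d_mult field_closure.fc_add field_closure.fc_mult)
  next
    case (fc_uminus x)
    then show ?case by (simp add: D.d_uminus field_closure.fc_uminus)
  qed
  note [simp] = DS
  have \<delta>h: "\<delta> (h x) = h (D x)" if "x \<in> S" for x using that by (simp add: \<delta>_def)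
  have hi: "h x = h y \<longleftrightarrow> x = y" if "x \<in> S" "y \<in> S" for x y using h that by (auto dest: inj_onD)
  have ext: "diff_field_extension d E \<delta> \<iota>"
  proof
    show "\<iota> \<in> ring_hom ring_of_type_algebra E"
      using hom_on_1[OF j] hom_on_add[OF j] hom_on_mult[OF j]
      by (intro ring_hom_memI) (auto simp: ring_of_type_algebra_def \<iota>_def ts)
  qed (auto simp: ts \<delta>h D.d_add D.d_mult \<iota>_def Dj)
  have const': "{x \<in> carrier E. \<delta> x = \<zero>\<^bsub>E\<^esub>} = \<iota> ` constants d"
  proof (intro subset_antisym subsetI)
    fix x assume "x \<in> {x \<in> carrier E. \<delta> x = \<zero>\<^bsub>E\<^esub>}"
    then obtain a where a: "a \<in> S" "x = h a" "h (D a) = h 0" by (auto simp: ts \<delta>h)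
    then have "D a = 0" by (simp add: hi)
    from const[OF a(1) this] show "x \<in> \<iota> ` constants d" using a by (auto simp: \<iota>_def)
  next
    fix x assume "x \<in> \<iota> ` constants d"
    moreover have "j 0 = 0" by (rule hom_on_0[OF j]) (simp add: is_subring_def)
    ultimately show "x \<in> {x \<in> carrier E. \<delta> x = \<zero>\<^bsub>E\<^esub>}"
      by (auto simp: \<iota>_def ts \<delta>h Dj constants_def)
  qed
  define F' where "F' = map_matrix h F"
  \<comment> \<open>The inverse of F, column by column, from Cramer's rule: as quotients of
    determinants over S its entries lie in S.\<close>
  define Q where "Q = (\<chi> k i. det (\<chi> m n. if n = k then axis i 1 $ m else F $ m $ n) / det F)"
  have "hom_on S (\<lambda>x. x)" by (simp add: hom_on_def)
  note detS = hom_on_det(2)[OF this SS]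
  have QS: "Q $ i $ k \<in> S" for i k
  proof -
    have "det (\<chi> m n. if n = i then axis k 1 $ m else F $ m $ n) \<in> S"
      by (rule detS) (simp add: axis_def)
    moreover have "det F \<in> S" by (rule detS) simp
    ultimately show ?thesis unfolding Q_def S by (simp add: field_closure_divide)
  qed
  have "F *v (\<chi> k. Q $ k $ i) = axis i 1" for i
    using cramer[OF F, of "\<chi> k. Q $ k $ i" "axis i 1"] by (simp add: Q_def)
  then have FQ: "(\<Sum>k\<in>UNIV. F $ i $ k * Q $ k $ m) = (if i = m then 1 else 0)" for i m
    by (simp add: vec_eq_iff matrix_vector_mult_def axis_def)
  then have "F ** Q = mat 1" by (simp add: matrix_matrix_mult_def mat_def vec_eq_iff)
  then have "Q ** F = mat 1" using matrix_left_right_inverse by blast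
  then have QF: "(\<Sum>k\<in>UNIV. Q $ i $ k * F $ k $ m) = (if i = m then 1 else 0)" for i m
    by (simp add: matrix_matrix_mult_def mat_def vec_eq_iff)
  have fm: "fundamental_matrix E \<delta> \<iota> N F'"
    unfolding fundamental_matrix_def
  proof (intro conjI allI exI[of _ "map_matrix h Q"])
    show "\<delta> (F' $ i $ k) = (\<Oplus>\<^bsub>E\<^esub>m\<in>UNIV. \<iota> (N $ i $ m) \<otimes>\<^bsub>E\<^esub> F' $ m $ k)" for i k
      by (simp add: F'_def \<iota>_def ts \<delta>h DF sum)
  qed (auto simp: F'_def ts QS sum FQ QF)
  have "carrier E = generate_field E (range \<iota> \<union> {F' $ i $ k | i k. True})"
    unfolding E_def by (rule transport_generate[OF h S]) (auto simp: F'_def \<iota>_def)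
  then show ?thesis
    using ext const' fm unfolding picard_vessiot_def by blast
qed

section \<open>Existence of a Picard-Vessiot extension\<close>

context field_derivation_0
begin

lemma picard_vessiot_ex:
  fixes N :: "'a ^ 'l::finite ^ 'l"
  assumes ac: "constants_alg_closed d"
  shows "\<exists>(E :: 'a ring) \<delta> \<iota>. picard_vessiot d N E \<delta> \<iota>"
proof -
  include cardinal_syntax
  obtain f0 where "solution N f0" using solution_ex by blast
  from ex_has_least_nat[of "solution N", OF this, of "trdeg K"]
  obtain f where f: "solution N f" and min: "\<And>g. solution N g \<Longrightarrow> trdeg K f \<le> trdeg K g" by blast
  obtain es where es: "set es = (UNIV :: ('l \<times> 'l) set)" using finite_list[OF finite] by blast
  define A where "A = adjoin_list K (map f es)"
  have A: "is_subring A" "K \<subseteq> A" "range f \<subseteq> A"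
    unfolding A_def using is_subring_adjoin_list[OF K_subring] adjoin_list_base[OF K_subring]
      adjoin_list_gen[OF K_subring, of "map f es"] es by auto
  define j where "j = fps_to_fls \<circ> temb"
  define F where "F = (\<chi> i k. fps_to_fls (f (i, k)))"
  define G where "G = range j \<union> {F $ i $ k | i k. True}"
  have sum': "fps_to_fls (sum s I) = (\<Sum>i\<in>I. fps_to_fls (s i))" for s ::
    "'b \<Rightarrow> 'a alg_closure fps" and I
    by (induction I rule: infinite_finite_induct) auto
  \<comment> \<open>Every element of the generated field is a fraction z = x / y over the ring A,
    written without division so that x and y remain power series.\<close>
  have frac: "\<exists>x\<in>A. \<exists>y\<in>A. y \<noteq> 0 \<and> z * fps_to_fls y = fps_to_fls x" if "z \<in> field_closure G" for z
    using that
  proof induction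
    case (fc_base z)
    then have "\<exists>x\<in>A. z = fps_to_fls x"
      using A(2) subsetD[OF A(3) rangeI] by (auto simp: G_def j_def F_def K_def)
    then show ?case using is_subring_1[OF A(1)]
      by (metis fps_one_to_fls mult.right_neutral zero_neq_one)
  next
    case fc_1
    then show ?case using is_subring_1[OF A(1)] by (intro bexI[of _ 1]) auto
  next
    case (fc_add z w)
    then obtain x y u v where "x \<in> A" "y \<in> A" "y \<noteq> 0" "z * fps_to_fls y = fps_to_fls x"
      "u \<in> A" "v \<in> A" "v \<noteq> 0" "w * fps_to_fls v = fps_to_fls u" by blast
    then show ?case
      by (intro bexI[of _ "x * v + u * y"] bexI[of _ "y * v"])
        (auto simp: fls_times_fps_to_fls algebra_simps intro!: is_subring_add[OF A(1)]
          is_subring_mult[OF A(1)])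
  next
    case (fc_mult z w)
    then obtain x y u v where "x \<in> A" "y \<in> A" "y \<noteq> 0" "z * fps_to_fls y = fps_to_fls x"
      "u \<in> A" "v \<in> A" "v \<noteq> 0" "w * fps_to_fls v = fps_to_fls u" by blast
    then show ?case
      by (intro bexI[of _ "x * u"] bexI[of _ "y * v"])
        (auto simp: fls_times_fps_to_fls algebra_simps intro!: is_subring_mult[OF A(1)])
  next
    case (fc_uminus z)
    then obtain x y where "x \<in> A" "y \<in> A" "y \<noteq> 0" "z * fps_to_fls y = fps_to_fls x" by blast
    then show ?case
      by (intro bexI[of _ "- x"] bexI[of _ y]) (auto intro!: is_subring_uminus[OF A(1)])
  next
    case (fc_inverse z)
    then obtain x y where xy: "x \<in> A" "y \<in> A" "y \<noteq> 0" "z * fps_to_fls y = fps_to_fls x" by blast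
    moreover have "x \<noteq> 0"
    proof
      assume "x = 0"
      then have "z * fps_to_fls y = 0" using xy by simp
      then show False using xy(3) fc_inverse(2) by simp
    qed
    ultimately show ?case using fc_inverse(2)
      by (intro bexI[of _ y] bexI[of _ x]) (auto simp: xy(4)[symmetric])
  qed
  have hj: "hom_on UNIV j"
    by (simp add: hom_on_def j_def fls_times_fps_to_fls)
  have "det F = fps_to_fls (det (\<chi> i j. f (i, j)))"
  proof -
    have "hom_on UNIV (fps_to_fls :: 'a alg_closure fps \<Rightarrow> _)"
      by (simp add: hom_on_def fls_times_fps_to_fls)
    from hom_on_det(1)[OF this UNIV_subring, of "\<chi> i j. f (i, j)"]
    show ?thesis by (simp add: F_def map_matrix_def)
  qed
  then have det: "det F \<noteq> 0" using f by (simp add: solution_def)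
  have DF: "fls_deriv (F $ i $ k) = (\<Sum>m\<in>UNIV. j (N $ i $ m) * F $ m $ k)" for i k
    using f by (simp add: F_def solution_def fls_deriv_fps_to_fls sum' j_def fls_times_fps_to_fls)
  have const: "x \<in> j ` constants d" if x: "x \<in> field_closure G" "fls_deriv x = 0" for x
  proof -
    \<comment> \<open>In characteristic 0 a Laurent series with derivative 0 is a scalar, so a
      constant of the generated field has the form that \<open>no_new_constants\<close>
      treats.\<close>
    obtain c where c: "x = fls_const c" using x(2) fls_deriv_eq_0_iff by blast
    obtain u y where uy: "u \<in> A" "y \<in> A" "y \<noteq> 0" "x * fps_to_fls y = fps_to_fls u"
      using frac[OF x(1)] by blast
    have "fps_to_fls (fps_const c * y) = fps_to_fls u"
      using uy(4) by (simp add: c fls_times_fps_to_fls)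
    then have "fps_const c * y = u" by simp
    from no_new_constants[OF ac f min es uy(1-3)[unfolded A_def] this]
    obtain a where a: "a \<in> constants d" "c = to_ac a" by blast
    then have "x = j a" using temb_const[of a] by (simp add: c j_def constants_def)
    then show ?thesis using a by blast
  qed
  have inf: "infinite (UNIV :: 'a set)" by (rule infinite_UNIV_char_0)
  have "|range j| \<le>o |UNIV :: 'a set|" by (rule card_of_image)
  moreover have "|{F $ i $ k | i k. True}| \<le>o |UNIV :: 'a set|"
  proof -
    have "{F $ i $ k | i k. True} = (\<lambda>(i, k). F $ i $ k) ` UNIV" by auto
    then have "finite {F $ i $ k | i k. True}" by simp
    then show ?thesis
      using inf ordLess_imp_ordLeq[OF finite_ordLess_infinite[OF card_of_Well_order
        card_of_Well_order]]
      by (simp add: Field_card_of)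
  qed
  ultimately have "|G| \<le>o |UNIV :: 'a set|"
    unfolding G_def using inf
    by (intro card_of_Un_ordLeq_infinite_Field card_of_Card_order) (simp_all add: Field_card_of)
  from field_closure_card[OF inf this]
  obtain h :: "'a alg_closure fls \<Rightarrow> 'a" where h: "inj_on h (field_closure G)"
    unfolding card_of_ordLeq[symmetric] by blast
  have D: "field_derivation (fls_deriv :: 'a alg_closure fls \<Rightarrow> _)"
    by standard simp_all
  show ?thesis
    by (rule picard_vessiot_transport[where D = fls_deriv and j = j and F = F and h = h
          and S = "field_closure G", OF field_derivation_axioms D hj _ _ _ det _ h])
      (use DF const in \<open>simp_all add: G_def j_def fls_deriv_fps_to_fls\<close>)
qed

end

subsection \<open>Derivative of a determinant\<close>

lemma matrix_mul_add_rdistrib: "(A + B) ** C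
  = A ** C + B ** (C :: 'r::comm_ring_1 ^ 'n ^ 'm::finite)"
  by (simp add: vec_eq_iff matrix_matrix_mult_def sum.distrib distrib_right)

lemma matrix_mul_diff_ldistrib: "A ** (B - C)
  = A ** B - A ** (C :: 'r::comm_ring_1 ^ 'n ^ 'm::finite)"
  by (simp add: vec_eq_iff matrix_matrix_mult_def sum_subtractf right_diff_distrib)

lemma matrix_mul_diff_rdistrib: "(A - B) ** C
  = A ** C - B ** (C :: 'r::comm_ring_1 ^ 'n ^ 'm::finite)"
  by (simp add: vec_eq_iff matrix_matrix_mult_def sum_subtractf left_diff_distrib)

lemma matrix_mul_sum_left:
  "sum A I ** C = (\<Sum>i\<in>I. A i ** (C :: 'r::comm_ring_1 ^ 'n ^ 'm::finite))"
  by (induction I rule: infinite_finite_induct) (auto simp: matrix_mul_add_rdistrib)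

lemma matrix_mul_sum_right:
  "C ** sum A I = (\<Sum>i\<in>I. C ** (A i :: 'r::comm_ring_1 ^ 'n ^ 'm::finite))"
  by (induction I rule: infinite_finite_induct) (auto simp: matrix_add_ldistrib)

lemma matrix_mul_uminus_right: "A ** (- C) = - (A ** (C :: 'r::comm_ring_1 ^ 'n ^ 'm::finite))"
  by (simp add: vec_eq_iff matrix_matrix_mult_def sum_negf)

lemma map_matrix_id: "map_matrix (\<lambda>a. a) A = A"
  by (simp add: map_matrix_def)

lemma mat_mul_commute: "A ** mat c = mat c ** (A :: 'r::comm_ring_1 ^ 'n::finite ^ 'n)"
  by (simp add: vec_eq_iff matrix_matrix_mult_def mat_def if_distrib[of "\<lambda>x. _ * x"]
      if_distrib[of "\<lambda>x. x * _"] mult.commute cong: if_cong)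

lemma
  assumes "invertible A"
  shows matrix_inv_right: "A ** matrix_inv A = mat 1"
    and matrix_inv_left: "matrix_inv A ** A = mat 1"
  using someI_ex[OF assms[unfolded invertible_def]] by (simp_all add: matrix_inv_def)

lemma invertible_nonzero:
  fixes A :: "'r::comm_ring_1 ^ 'n::finite ^ 'n"
  assumes "invertible A"
  shows "A \<noteq> 0"
proof
  assume "A = 0"
  then have "(A ** matrix_inv A) $ i $ i = 0" for i
    by (simp add: matrix_matrix_mult_def)
  then show False using matrix_inv_right[OF assms] by (simp add: mat_def)
qed

lemma deriv_prod:
  assumes "derivation \<delta>" "finite I"
  shows "\<delta> (prod f I) = (\<Sum>i\<in>I. \<delta> (f i) * prod f (I - {i}))"
  using assms(2)
proof (induction I rule: finite_induct)
  case empty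
  then show ?case by (simp add: deriv_1[OF assms(1)])
next
  case (insert a I)
  have "prod f (insert a I - {i}) = f a * prod f (I - {i})" if "i \<in> I" for i
  proof -
    have "insert a I - {i} = insert a (I - {i})" using insert that by auto
    then show ?thesis using insert by simp
  qed
  then have "(\<Sum>i\<in>I. \<delta> (f i) * prod f (insert a I - {i})) = f a * \<delta> (prod f I)"
    unfolding insert.IH by (simp add: sum_distrib_left ac_simps)
  then show ?case using insert by (simp add: deriv_mult[OF assms(1)])
qed

lemma coeff_1_prod:
  fixes a b :: "'i \<Rightarrow> 'r::comm_ring_1"
  assumes "finite I"
  shows "coeff (\<Prod>i\<in>I. [:a i, b i:]) 0 = prod a I \<and>
    coeff (\<Prod>i\<in>I. [:a i, b i:]) (Suc 0) = (\<Sum>i\<in>I. b i * prod a (I - {i}))"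
  using assms
proof (induction I rule: finite_induct)
  case (insert c I)
  have "prod a (insert c I - {i}) = a c * prod a (I - {i})" if "i \<in> I" for i
  proof -
    have "insert c I - {i} = insert c (I - {i})" using insert that by auto
    then show ?thesis using insert by simp
  qed
  then have "(\<Sum>i\<in>I. b i * prod a (insert c I - {i})) = a c * (\<Sum>i\<in>I. b i * prod a (I - {i}))"
    by (simp add: sum_distrib_left ac_simps)
  then show ?case using insert by (simp add: coeff_mult)
qed simp

text \<open>The derivative of \<open>det\<close> at M in the direction H, that is, the trace of
  adj(M) H in Jacobi's formula, expanded over permutations.\<close>

definition det_diff :: "'r::comm_ring_1 ^ 'n::finite ^ 'n \<Rightarrow> 'r ^ 'n ^ 'n \<Rightarrow> 'r"
  where "det_diff M H = (\<Sum>p | p permutes UNIV. of_int (sign p) *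
    (\<Sum>i\<in>UNIV. H $ i $ p i * (\<Prod>k\<in>UNIV - {i}. M $ k $ p k)))"

lemma det_diff_minus: "det_diff M (H - H') = det_diff M H - det_diff M H'"
  by (simp add: det_diff_def left_diff_distrib sum_subtractf right_diff_distrib)

lemma deriv_det:
  assumes "derivation \<delta>"
  shows "\<delta> (det M) = det_diff M (map_matrix \<delta> M)"
  by (simp add: det_def det_diff_def deriv_sum[OF assms] deriv_mult[OF assms]
      deriv_of_int[OF assms] deriv_prod[OF assms])

text \<open>First order perturbation: the polynomial variable plays the role of an infinitesimal.\<close>

lemma det_diff_coeff: "det_diff M H = coeff (det (\<chi> i j. [:M $ i $ j, H $ i $ j:])) 1"
proof -
  have "coeff (of_int k * q) n = of_int k * coeff q n" for k n and q :: "'a poly"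
    by (simp add: of_int_poly)
  then show ?thesis
    unfolding det_def det_diff_def by (simp add: coeff_sum coeff_1_prod)
qed

text \<open>Put P = 1 + x N. The determinants of P M and M P agree, and their linear coefficients in
  x are the derivatives of \<open>det\<close> at M in the directions N M and M N. Thus M need not be
  invertible.\<close>

lemma det_diff_commutator:
  fixes M N :: "'r::comm_ring_1 ^ 'n::finite ^ 'n"
  shows "det_diff M (N ** M - M ** N) = 0"
proof -
  define P where "P = (\<chi> i j. [:mat 1 $ i $ j, N $ i $ j:])"
  define M' where "M' = (\<chi> i j. [:M $ i $ j:])"
  have s: "(\<Sum>k\<in>UNIV. [:f k, g k:]) = [:\<Sum>k\<in>UNIV. f k, \<Sum>k\<in>UNIV. g k:]" for f g :: "'n \<Rightarrow> 'r"
    by (rule poly_eqI) (simp add: coeff_sum coeff_pCons split: nat.split)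
  have m: "mat 1 $ i $ j = (if i = j then 1 else 0 :: 'r)" for i j :: 'n by (simp add: mat_def)
  have "P ** M' = (\<chi> i j. [:M $ i $ j, (N ** M) $ i $ j:])"
    by (simp add: vec_eq_iff P_def M'_def matrix_matrix_mult_def m mult.commute[of _ "[:_:]"] s
        if_distrib[of "\<lambda>x. _ * x"] cong: if_cong) (simp add: mult.commute)
  moreover have "M' ** P = (\<chi> i j. [:M $ i $ j, (M ** N) $ i $ j:])"
    by (simp add: vec_eq_iff P_def M'_def matrix_matrix_mult_def m s
        if_distrib[of "\<lambda>x. x * _"] mult.commute[of "M $ _ $ _"] cong: if_cong)
  ultimately have "det_diff M (N ** M) = det_diff M (M ** N)"
    unfolding det_diff_coeff by (metis det_mul mult.commute)
  then show ?thesis by (simp add: det_diff_minus)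
qed

subsection \<open>Right remainders of operators\<close>

lemma
  assumes "derivation \<delta>"
  shows map_deriv_add: "map_matrix \<delta> (A + B) = map_matrix \<delta> A + map_matrix \<delta> B"
    and map_deriv_diff: "map_matrix \<delta> (A - B) = map_matrix \<delta> A - map_matrix \<delta> B"
    and map_deriv_mult: "map_matrix \<delta> (A ** C) = map_matrix \<delta> A ** C + A ** map_matrix \<delta> C"
    and map_deriv_sum: "map_matrix \<delta> (\<Sum>i\<in>I. f i) = (\<Sum>i\<in>I. map_matrix \<delta> (f i))"
    and map_deriv_mat: "\<delta> c = 0 \<Longrightarrow> map_matrix \<delta> (mat c) = 0"
  by (simp_all add: vec_eq_iff deriv_add[OF assms] deriv_diff[OF assms] deriv_mult[OF assms]
      deriv_sum[OF assms] deriv_0[OF assms] matrix_matrix_mult_def sum.distrib mat_def)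

text \<open>Used for two homomorphisms: the embedding of K in K[\<lambda>,\<mu>], which yields the
  resultant, and the identity of K, which yields its specialisation at a point.\<close>

locale diff_hom = field_derivation d for d :: "'a::field \<Rightarrow> 'a" +
  fixes e :: "'a \<Rightarrow> 'r::comm_ring_1" and \<delta> :: "'r \<Rightarrow> 'r"
  assumes e: "hom_on UNIV e" and \<delta>: "derivation \<delta>" and \<delta>e: "\<delta> (e a) = e (d a)"
begin

lemma e_simps: "e 0 = 0" "e 1 = 1" "e (x + y) = e x + e y" "e (x * y) = e x * e y"
    "e (x - y) = e x - e y"
  and e_sum: "e (sum f I) = (\<Sum>i\<in>I. e (f i))"
  using hom_on_0[OF e] hom_on_1[OF e] hom_on_add[OF e] hom_on_mult[OF e] hom_on_diff[OF e]
    hom_on_sum[OF e]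
  by (simp_all add: is_subring_def)

abbreviation em :: "'a ^ 'n ^ 'm \<Rightarrow> 'r ^ 'n ^ 'm"
  where "em \<equiv> map_matrix e"

lemma em_add: "em (A + B) = em A + em B"
  and em_mult: "em (A ** C) = em A ** em C"
  and em_mat: "em (mat c) = mat (e c)"
  and em_0: "em 0 = 0"
  and em_d: "map_matrix \<delta> (em A) = em (map_matrix d A)"
  by (simp_all add: vec_eq_iff e_simps e_sum \<delta>e matrix_matrix_mult_def mat_def)

text \<open>The remainder of P on right division by D - N: modulo left multiples of D - N the power
  D^j is congruent to p_j(N).\<close>

definition rem_eval :: "'r ^ 'l::finite ^ 'l \<Rightarrow> ('a, 'l) odo \<Rightarrow> 'r ^ 'l ^ 'l"
  where "rem_eval N P = (\<Sum>j\<le>degree P. em (coeff P j) ** p_seq \<delta> N j)"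

lemma rem_eval_upto: "degree P \<le> n \<Longrightarrow> rem_eval N P = (\<Sum>j\<le>n. em (coeff P j) ** p_seq \<delta> N j)"
  unfolding rem_eval_def by (rule sum.mono_neutral_left) (auto simp: coeff_eq_0 em_0)

lemma rem_eval_add: "rem_eval N (P + Q) = rem_eval N P + rem_eval N Q"
  using rem_eval_upto[of P "max (degree P) (degree Q)"] rem_eval_upto[of Q
    "max (degree P) (degree Q)"]
    rem_eval_upto[OF degree_add_le_max]
  by (simp add: em_add matrix_mul_add_rdistrib sum.distrib)

lemma rem_eval_0: "rem_eval N 0 = 0"
  by (simp add: rem_eval_def em_0)

lemma rem_eval_sum: "rem_eval N (sum P I) = (\<Sum>i\<in>I. rem_eval N (P i))"
  by (induction I rule: infinite_finite_induct) (auto simp: rem_eval_0 rem_eval_add)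

lemma rem_eval_lmult: "rem_eval N (map_poly (\<lambda>A. C ** A) Q) = em C ** rem_eval N Q"
  using rem_eval_upto[OF map_poly_degree_leq[of "\<lambda>A. C ** A" Q]]
  by (simp add: rem_eval_def coeff_map_poly em_mult matrix_mul_sum_right matrix_mul_assoc)

text \<open>If Q has remainder R, then D Q is congruent to D R = R D + R', and D may be replaced by
  N on the right.\<close>

lemma rem_eval_D: "rem_eval N (odo_D d Q) = rem_eval N Q ** N + map_matrix \<delta> (rem_eval N Q)"
proof -
  define n where "n = degree Q"
  have "rem_eval N (map_poly (map_matrix d) Q)
    = (\<Sum>j\<le>n. map_matrix \<delta> (em (coeff Q j)) ** p_seq \<delta> N j)"
    using rem_eval_upto[OF map_poly_degree_leq[of "map_matrix d" Q]]
    by (simp add: n_def coeff_map_poly em_d d_0 vec_eq_iff)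
  moreover have "rem_eval N (pCons 0 Q) = (\<Sum>j\<le>n. em (coeff Q j) ** p_seq \<delta> N (Suc j))"
    by (subst rem_eval_upto[of _ "Suc n"])
      (simp_all add: n_def degree_pCons_le sum.atMost_Suc_shift em_0 del: p_seq.simps(2)
        sum.atMost_Suc)
  moreover have "rem_eval N (odo_D d Q)
    = rem_eval N (map_poly (map_matrix d) Q) + rem_eval N (pCons 0 Q)"
    by (simp add: odo_D_def rem_eval_add)
  moreover have "rem_eval N Q = (\<Sum>j\<le>n. em (coeff Q j) ** p_seq \<delta> N j)"
    by (simp add: rem_eval_def n_def)
  ultimately show ?thesis
    by (simp add: map_deriv_sum[OF \<delta>] map_deriv_mult[OF \<delta>] matrix_add_ldistrib sum.distrib
        matrix_mul_sum_left matrix_mul_assoc)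
qed

text \<open>Remainders are not multiplicative in general. Here the remainder of Q is a constant
  scalar, which commutes with D and with every matrix, so P Q is congruent to c P.\<close>

lemma rem_eval_mult_scalar:
  assumes "rem_eval N Q = mat c" "\<delta> c = 0"
  shows "rem_eval N (odo_mult d P Q) = mat c ** rem_eval N P"
proof -
  have "rem_eval N ((odo_D d ^^ i) Q) = mat c ** p_seq \<delta> N i" for i
  proof (induction i)
    case (Suc i)
    then show ?case
      by (simp add: rem_eval_D map_deriv_mult[OF \<delta>] map_deriv_mat[OF \<delta> assms(2)] matrix_add_ldistrib
          matrix_mul_assoc)
  qed (simp add: assms)
  then have "rem_eval N (odo_mult d P Q) = (\<Sum>i\<le>degree P. em (coeff P i) ** (mat c ** p_seq \<delta> N i))"
    by (simp add: odo_mult_def rem_eval_sum rem_eval_lmult)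
  then show ?thesis
    by (simp add: rem_eval_def matrix_mul_sum_right matrix_mul_assoc mat_mul_commute)
qed

text \<open>Both products are reduced modulo D - N. As L is congruent to the scalar c, the remainder
  of B L is c H = (A0 + A1 N) H, while that of L B is A0 H + A1 (H N + H'). Cancelling A0 H and then
  the invertible A1 leaves the commutator equation.\<close>

lemma rem_eval_commutator:
  assumes A1: "invertible A1" and comm: "odo_mult d [:A0, A1:] B = odo_mult d B [:A0, A1:]"
    and N: "em A0 + em A1 ** N = mat c" and c: "\<delta> c = 0"
  shows "map_matrix \<delta> (rem_eval N B) = N ** rem_eval N B - rem_eval N B ** N"
proof -
  let ?H = "rem_eval N B"
  note nz = invertible_nonzero[OF A1]
  have "rem_eval N [:A0, A1:] = mat c"
    using nz N deriv_1[OF \<delta>] deriv_0[OF \<delta>]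
    by (simp add: rem_eval_def map_deriv_mat[OF \<delta>])
  from rem_eval_mult_scalar[OF this c] have "rem_eval N (odo_mult d [:A0, A1:] B) = mat c ** ?H"
    using comm by simp
  moreover have "rem_eval N (odo_mult d [:A0, A1:] B)
    = em A0 ** ?H + em A1 ** (?H ** N + map_matrix \<delta> ?H)"
    using nz by (simp add: odo_mult_def rem_eval_add rem_eval_lmult rem_eval_D)
  ultimately have "em A0 ** ?H + em A1 ** (?H ** N + map_matrix \<delta> ?H)
    = em A0 ** ?H + em A1 ** N ** ?H"
    by (simp add: N[symmetric] matrix_mul_add_rdistrib)
  then have "em A1 ** (?H ** N + map_matrix \<delta> ?H) = em A1 ** (N ** ?H)"
    by (simp add: matrix_mul_assoc)
  then have "em (matrix_inv A1 ** A1) ** (?H ** N + map_matrix \<delta> ?H)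
    = em (matrix_inv A1 ** A1) ** (N ** ?H)"
    by (simp only: em_mult matrix_mul_assoc[symmetric])
  then have "?H ** N + map_matrix \<delta> ?H = N ** ?H"
    using matrix_inv_left[OF A1] by (simp add: em_mat e_simps)
  then show ?thesis by (metis add_diff_cancel_left')
qed

lemma shifted_commutator:
  assumes "map_matrix \<delta> (H :: 'r ^ 'l::finite ^ 'l) = N ** H - H ** N" "\<delta> m = 0"
  shows "map_matrix \<delta> (H - mat m) = N ** (H - mat m) - (H - mat m) ** N"
    and "\<delta> (det (H - mat m)) = 0"
proof -
  show *: "map_matrix \<delta> (H - mat m) = N ** (H - mat m) - (H - mat m) ** N"
    by (simp add: map_deriv_diff[OF \<delta>] assms map_deriv_mat[OF \<delta>] matrix_mul_diff_ldistrib
        matrix_mul_diff_rdistrib mat_mul_commute)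
  show "\<delta> (det (H - mat m)) = 0"
    unfolding deriv_det[OF \<delta>] * by (rule det_diff_commutator)
qed

end

subsection \<open>Constancy of the coefficients of the resultant\<close>

lemma derivation_map_poly:
  assumes "derivation \<delta>"
  shows "derivation (map_poly \<delta>)"
  unfolding derivation_def
  by (auto simp: poly_eq_iff coeff_map_poly deriv_0[OF assms] deriv_add[OF assms] coeff_mult
      deriv_sum[OF assms] deriv_mult[OF assms] sum.distrib)

context field_derivation
begin

lemma derivation_lift: "derivation (lift_deriv d)"
  unfolding lift_deriv_def by (intro derivation_map_poly derivation_d)

lemma lift_deriv_lam: "lift_deriv d lam = 0" and lift_deriv_mu: "lift_deriv d mu = 0"
  using deriv_1[OF derivation_map_poly[OF derivation_d]]
  by (simp_all add: lift_deriv_def lam_def mu_def map_poly_pCons d_0 d_1)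

lemma lift_hom: "hom_on UNIV (\<lambda>a::'a. [:[:a:]:])"
  by (simp add: hom_on_def one_pCons)

lemma diff_hom_lift: "diff_hom d (\<lambda>a. [:[:a:]:]) (lift_deriv d)"
  using derivation_lift lift_hom
  by unfold_locales (simp_all add: lift_deriv_def map_poly_pCons d_0)

lemma diff_hom_id: "diff_hom d (\<lambda>a. a) d"
  using derivation_d by unfold_locales (simp_all add: hom_on_def)

interpretation lift: diff_hom d "\<lambda>a. [:[:a:]:]" "lift_deriv d"
  by (rule diff_hom_lift)

interpretation base: diff_hom d "\<lambda>a. a" d
  by (rule diff_hom_id)

lemma M_mat_rem_eval: "M_mat d L B = lift.rem_eval (N_lam L) B - mat mu"
proof -
  have "{..degree B} = insert 0 {1..degree B}" by auto
  then show ?thesis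
    by (simp add: M_mat_def lift.rem_eval_def lift_mat_def)
qed

lemma N_lam_eq:
  fixes A0 A1 :: "'a ^ 'l::finite ^ 'l"
  assumes "invertible A1"
  shows "lift_mat A0 + lift_mat A1 ** N_lam [:A0, A1:] = mat lam"
proof -
  have "lift_mat A1 ** lift_mat (matrix_inv A1) = mat 1"
    using matrix_inv_right[OF assms] lift.em_mult[of A1 "matrix_inv A1"]
    by (simp add: lift_mat_def lift.em_mat lift.e_simps)
  then show ?thesis by (simp add: N_lam_def matrix_mul_uminus_right matrix_mul_assoc)
qed

lemma N_at_eq:
  fixes A0 A1 :: "'a ^ 'l::finite ^ 'l"
  assumes "invertible A1"
  shows "A0 + A1 ** N_at [:A0, A1:] l = mat l"
using matrix_inv_right[OF assms] by (simp add: N_at_def matrix_mul_uminus_right matrix_mul_assoc)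

lemma DRes_coeff_constant:
  fixes A0 A1 :: "'a ^ 'l::finite ^ 'l"
  assumes "invertible A1" "odo_mult d [:A0, A1:] B = odo_mult d B [:A0, A1:]"
  shows "coeff (coeff (DRes d [:A0, A1:] B) i) j \<in> constants d"
proof -
  have "lift_deriv d (DRes d [:A0, A1:] B) = 0"
    unfolding DRes_def M_mat_rem_eval
    by (rule lift.shifted_commutator(2)[OF lift.rem_eval_commutator[OF assms] lift_deriv_mu])
      (use N_lam_eq[OF assms(1)] lift_deriv_lam in \<open>simp_all add: lift_mat_def\<close>)
  then have "coeff (coeff (lift_deriv d (DRes d [:A0, A1:] B)) i) j = 0" by simp
  then show ?thesis by (simp add: lift_deriv_def coeff_map_poly d_0 constants_def)
qed

section \<open>Specialisation of the resultant at a constant point\<close>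

lemma eval2_hom: "hom_on UNIV (\<lambda>f. eval2 f l m)"
  by (simp add: hom_on_def eval2_def)

text \<open>This is where the point has to be constant: otherwise the chain rule would contribute
  terms in d l and d m.\<close>

lemma eval2_lift_deriv:
  assumes "d l = 0" "d m = 0"
  shows "eval2 (lift_deriv d f) l m = d (eval2 f l m)"
proof -
  have 1: "poly (map_poly d p) l = d (poly p l)" for p
    by (induction p) (simp_all add: map_poly_pCons d_0 d_add d_mult assms)
  have "poly (poly (map_poly (map_poly d) f) [:m:]) l = d (poly (poly f [:m:]) l)"
    by (induction f) (simp_all add: map_poly_pCons d_0 d_add d_mult assms 1)
  then show ?thesis by (simp add: eval2_def lift_deriv_def)
qed

definition M_at :: "('a, 'l::finite) odo \<Rightarrow> ('a, 'l) odo \<Rightarrow> 'a \<Rightarrow> 'a \<Rightarrow> 'a ^ 'l ^ 'l"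
  where "M_at L B l m = base.rem_eval (N_at L l) B - mat m"

text \<open>Evaluation at a constant point is a ring homomorphism that respects the derivations, so
  it passes through the recursion for the p_j and through the determinant.\<close>

lemma eval2_DRes:
  fixes L B :: "('a, 'l::finite) odo"
  assumes "d l = 0" "d m = 0"
  shows "eval2 (DRes d L B) l m = det (M_at L B l m)"
proof -
  let ?\<phi> = "\<lambda>f. eval2 f l m"
  note hom = hom_on_0[OF eval2_hom] hom_on_1[OF eval2_hom] hom_on_add[OF eval2_hom]
    hom_on_mult[OF eval2_hom]
    hom_on_diff[OF eval2_hom] hom_on_sum[OF eval2_hom] hom_on_uminus[OF eval2_hom]
  have U: "is_subring UNIV" by (simp add: is_subring_def)
  have mult: "map_matrix ?\<phi> (H ** Y) = map_matrix ?\<phi> H ** map_matrix ?\<phi> Y"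
    for H Y :: "'a poly poly ^ 'l ^ 'l"
    by (simp add: vec_eq_iff matrix_matrix_mult_def hom U)
  have lift: "map_matrix ?\<phi> (lift_mat H) = H" for H :: "'a ^ 'l ^ 'l"
    by (simp add: vec_eq_iff lift_mat_def eval2_def)
  have mat: "map_matrix ?\<phi> (mat x) = mat (?\<phi> x)" for x :: "'a poly poly"
    by (simp add: vec_eq_iff mat_def hom U)
  have add: "map_matrix ?\<phi> (H + Y) = map_matrix ?\<phi> H + map_matrix ?\<phi> Y"
    "map_matrix ?\<phi> (H - Y) = map_matrix ?\<phi> H - map_matrix ?\<phi> Y"
    "map_matrix ?\<phi> (- H) = - map_matrix ?\<phi> H"
    "map_matrix ?\<phi> (\<Sum>i\<in>I. f i) = (\<Sum>i\<in>I. map_matrix ?\<phi> (f i))"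
    for H Y :: "'a poly poly ^ 'l ^ 'l" and I :: "nat set" and f
    by (simp_all add: vec_eq_iff hom U)
  have N: "map_matrix ?\<phi> (N_lam L) = N_at L l"
    unfolding N_lam_def N_at_def by (simp add: add mult lift mat) (simp add: eval2_def lam_def)
  have "map_matrix ?\<phi> (p_seq (lift_deriv d) (N_lam L) j) = p_seq d (N_at L l) j" for j
  proof (induction j)
    case 0
    then show ?case by (simp add: mat hom)
  next
    case (Suc j)
    have "map_matrix ?\<phi> (map_matrix (lift_deriv d) H) = map_matrix d (map_matrix ?\<phi> H)"
      for H :: "'a poly poly ^ 'l ^ 'l"
      by (simp add: vec_eq_iff eval2_lift_deriv assms)
    then show ?case by (simp add: add mult N Suc)
  qed
  then have "map_matrix ?\<phi> (M_mat d L B) = M_at L B l m"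
    unfolding M_mat_rem_eval M_at_def lift.rem_eval_def base.rem_eval_def
    by (simp add: add mult mat lift[unfolded lift_mat_def])
      (simp add: eval2_def mu_def map_matrix_def)
  then show ?thesis
    unfolding DRes_def using hom_on_det(1)[OF eval2_hom U, of "M_mat d L B"] by simp
qed

lemma M_at_deriv:
  fixes A0 A1 :: "'a ^ 'l::finite ^ 'l"
  assumes "invertible A1" "odo_mult d [:A0, A1:] B = odo_mult d B [:A0, A1:]" "d l = 0" "d m = 0"
  shows "map_matrix d (M_at [:A0, A1:] B l m) =
    N_at [:A0, A1:] l ** M_at [:A0, A1:] B l m - M_at [:A0, A1:] B l m ** N_at [:A0, A1:] l"
  unfolding M_at_def
  by (intro base.shifted_commutator(1) base.rem_eval_commutator[OF assms(1,2) _ assms(3)] assms(4))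
    (simp add: N_at_eq[OF assms(1)] map_matrix_id)

lemma M_at_expand:
  "(\<Sum>j\<le>degree B. coeff B j ** p_seq d (N_at L l) j) = M_at L B l m + mat m"
  by (simp add: M_at_def base.rem_eval_def map_matrix_def)

end

section \<open>Kernel vectors of singular matrices\<close>

lemma singular_kernel:
  fixes A :: "'a::field ^ 'n::finite ^ 'n"
  assumes "det A = 0"
  obtains v where "v \<noteq> 0" "A *v v = 0"
proof -
  have "\<nexists>B. B ** A = mat 1"
  proof
    assume "\<exists>B. B ** A = mat 1"
    then obtain B where "B ** A = mat 1" by blast
    then have "det B * det A = 1" using det_mul[of B A] by simp
    then show False using assms by simp
  qed
  then show ?thesis using that unfolding matrix_left_invertible_ker by blast
qed

text \<open>Take a kernel vector over K of minimal support. Since the matrix is constant, the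
  entrywise derivative of a kernel vector lies in the kernel again; after normalisation it has
  smaller support, so it vanishes.\<close>

lemma (in field_derivation) constant_kernel:
  fixes A :: "'a ^ 'n::finite ^ 'n"
  assumes A: "\<And>i j. A $ i $ j \<in> constants d" and "det A = 0"
  obtains v where "v \<noteq> 0" "A *v v = 0" "\<And>i. v $ i \<in> constants d"
proof -
  obtain v0 where "v0 \<noteq> 0" "A *v v0 = 0" using singular_kernel[OF assms(2)] .
  then have ex: "v0 \<noteq> 0 \<and> A *v v0 = 0" by simp
  obtain v where v: "v \<noteq> 0" "A *v v = 0"
    and min: "\<And>w. w \<noteq> 0 \<Longrightarrow> A *v w = 0 \<Longrightarrow> card {k. v $ k \<noteq> 0} \<le> card {k. w $ k \<noteq> 0}"
    using ex_has_least_nat[of "\<lambda>v. v \<noteq> 0 \<and> A *v v = 0", OF ex, of "\<lambda>v. card {k. v $ k \<noteq> 0}"]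
    by blast
  obtain i where i: "v $ i \<noteq> 0" using v by (auto simp: vec_eq_iff)
  \<comment> \<open>Scaling makes the entry at i equal to 1, so the derivative vanishes
    there.\<close>
  define u where "u = (\<chi> k. v $ k / v $ i)"
  have Av: "(\<Sum>k\<in>UNIV. A $ m $ k * v $ k) = 0" for m
    using v(2) by (simp add: vec_eq_iff matrix_vector_mult_def)
  have Au: "(\<Sum>k\<in>UNIV. A $ m $ k * u $ k) = 0" for m
    using Av[of m] by (simp add: u_def sum_divide_distrib[symmetric])
  define w where "w = (\<chi> k. d (u $ k))"
  have "(\<Sum>k\<in>UNIV. A $ m $ k * d (u $ k)) = d (\<Sum>k\<in>UNIV. A $ m $ k * u $ k)" for m
    using A by (simp add: d_sum d_mult constants_def)
  then have Aw: "A *v w = 0"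
    by (simp add: vec_eq_iff matrix_vector_mult_def w_def Au d_0)
  have "w = 0"
  proof (rule ccontr)
    assume "w \<noteq> 0"
    have "{k. w $ k \<noteq> 0} \<subseteq> {k. v $ k \<noteq> 0} - {i}"
      using i by (auto simp: w_def u_def d_0 d_1)
    then have "{k. w $ k \<noteq> 0} \<subset> {k. v $ k \<noteq> 0}" using i by blast
    then have "card {k. w $ k \<noteq> 0} < card {k. v $ k \<noteq> 0}" by (intro psubset_card_mono) auto
    then show False using min[OF \<open>w \<noteq> 0\<close> Aw] by simp
  qed
  then have "u $ k \<in> constants d" for k by (auto simp: w_def constants_def vec_eq_iff)
  moreover have "u \<noteq> 0" using i by (auto simp: u_def vec_eq_iff intro!: exI[of _ i])
  moreover have "A *v u = 0" using Au by (simp add: vec_eq_iff matrix_vector_mult_def)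
  ultimately show ?thesis using that by blast
qed

subsection \<open>Linear algebra over a differential extension\<close>

context diff_field_extension
begin

text \<open>The field E is a record with a carrier, so type class arithmetic does not describe it.
  Vectors and matrices keep their types, \<open>V\<close> and \<open>VM\<close> record membership in
  the carrier, and the products below use the operations of E.\<close>

definition V :: "('b ^ 'n::finite) set"
  where "V = {Y. \<forall>i. Y $ i \<in> carrier E}"

definition VM :: "('b ^ 'n::finite ^ 'm::finite) set"
  where "VM = {A. \<forall>i j. A $ i $ j \<in> carrier E}"

definition mv :: "'b ^ 'n::finite ^ 'm::finite \<Rightarrow> 'b ^ 'n \<Rightarrow> 'b ^ 'm"
  where "mv A Y = (\<chi> i. \<Oplus>k\<in>UNIV. A $ i $ k \<otimes> Y $ k)"

definition mm :: "'b ^ 'n::finite ^ 'm::finite \<Rightarrow> 'b ^ 'p::finite ^ 'n \<Rightarrow> 'b ^ 'p ^ 'm"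
  where "mm A B = (\<chi> i j. \<Oplus>k\<in>UNIV. A $ i $ k \<otimes> B $ k $ j)"

definition va :: "'b ^ 'n::finite \<Rightarrow> 'b ^ 'n \<Rightarrow> 'b ^ 'n"
  where "va Y Z = (\<chi> i. Y $ i \<oplus> Z $ i)"

definition vz :: "'b ^ 'n::finite"
  where "vz = (\<chi> i. \<zero>)"

definition dv :: "'b ^ 'n::finite \<Rightarrow> 'b ^ 'n"
  where "dv Y = (\<chi> i. \<delta> (Y $ i))"

definition iv :: "'a ^ 'n::finite \<Rightarrow> 'b ^ 'n"
  where "iv v = (\<chi> i. \<iota> (v $ i))"

abbreviation im :: "'a ^ 'n::finite ^ 'm::finite \<Rightarrow> 'b ^ 'n ^ 'm"
  where "im \<equiv> map_matrix \<iota>"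

lemma \<iota>_closed [simp]: "\<iota> a \<in> carrier E"
  using ring_hom_closed[OF \<iota>_hom] by (simp add: ring_of_type_algebra_def)

lemma \<iota>_add: "\<iota> (a + b) = \<iota> a \<oplus> \<iota> b"
  using ring_hom_add[OF \<iota>_hom, of a b] by (simp add: ring_of_type_algebra_def)

lemma \<iota>_mult: "\<iota> (a * b) = \<iota> a \<otimes> \<iota> b"
  using ring_hom_mult[OF \<iota>_hom, of a b] by (simp add: ring_of_type_algebra_def)

lemma \<iota>_1: "\<iota> 1 = \<one>"
  using ring_hom_one[OF \<iota>_hom] by (simp add: ring_of_type_algebra_def)

lemma \<iota>_0: "\<iota> 0 = \<zero>"
  using \<iota>_add[of 0 0] by (metis \<iota>_closed add_0 r_zero zero_closed add.l_cancel)

lemma \<iota>_eq_0: "\<iota> a = \<zero> \<longleftrightarrow> a = 0"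
proof
  assume a: "\<iota> a = \<zero>"
  show "a = 0"
  proof (rule ccontr)
    assume "a \<noteq> 0"
    then have "\<iota> a \<otimes> \<iota> (inverse a) = \<one>" by (simp add: \<iota>_mult[symmetric] \<iota>_1)
    then show False using a by simp
  qed
qed (simp add: \<iota>_0)

lemma \<iota>_sum: "\<iota> (sum f I) = (\<Oplus>i\<in>I. \<iota> (f i))"
proof (induction I rule: infinite_finite_induct)
  case (insert x I)
  have "(\<Oplus>i\<in>insert x I. \<iota> (f i)) = \<iota> (f x) \<oplus> (\<Oplus>i\<in>I. \<iota> (f i))"
    using insert.hyps by (intro finsum_insert) auto
  then show ?case using insert by (simp add: \<iota>_add)
qed (simp_all add: \<iota>_0 finsum_infinite)

lemma \<delta>_0: "\<delta> \<zero> = \<zero>"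
  using \<delta>_\<iota>[of 0] by (simp add: \<iota>_0 d_0)

lemma \<delta>_finsum:
  assumes "\<And>i. i \<in> I \<Longrightarrow> f i \<in> carrier E"
  shows "\<delta> (\<Oplus>i\<in>I. f i) = (\<Oplus>i\<in>I. \<delta> (f i))"
  using assms
proof (induction I rule: infinite_finite_induct)
  case (insert x I)
  have f: "f \<in> I \<rightarrow> carrier E" "(\<lambda>i. \<delta> (f i)) \<in> I \<rightarrow> carrier E" "f x \<in> carrier E"
    "\<delta> (f x) \<in> carrier E"
    using insert.prems \<delta>_closed by auto
  have "(\<Oplus>i\<in>insert x I. f i) = f x \<oplus> (\<Oplus>i\<in>I. f i)"
    "(\<Oplus>i\<in>insert x I. \<delta> (f i)) = \<delta> (f x) \<oplus> (\<Oplus>i\<in>I. \<delta> (f i))"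
    using insert.hyps f by (intro finsum_insert; simp)+
  then show ?case using insert f by (simp add: \<delta>_add finsum_closed)
qed (simp_all add: \<delta>_0 finsum_infinite)

lemma finsum_swap:
  assumes "finite I" "finite J" "\<And>i j. i \<in> I \<Longrightarrow> j \<in> J \<Longrightarrow> f i j \<in> carrier E"
  shows "(\<Oplus>i\<in>I. \<Oplus>j\<in>J. f i j) = (\<Oplus>j\<in>J. \<Oplus>i\<in>I. f i j)"
  using assms(1,3)
proof (induction I rule: finite_induct)
  case empty
  then show ?case by (simp add: finsum_zero)
next
  case (insert x I)
  have c: "(\<lambda>j. f i j) \<in> J \<rightarrow> carrier E" if "i \<in> insert x I" for i using insert.prems that by auto
  have c': "(\<lambda>i. f i j) \<in> I \<rightarrow> carrier E" "f x j \<in> carrier E" if "j \<in> J" for j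
    using insert.prems that by auto
  have "(\<Oplus>i\<in>insert x I. \<Oplus>j\<in>J. f i j) = (\<Oplus>j\<in>J. f x j) \<oplus> (\<Oplus>i\<in>I. \<Oplus>j\<in>J. f i j)"
    using insert.hyps c by (intro finsum_insert) (auto intro!: finsum_closed)
  also have "\<dots> = (\<Oplus>j\<in>J. f x j) \<oplus> (\<Oplus>j\<in>J. \<Oplus>i\<in>I. f i j)"
    using insert by simp
  also have "\<dots> = (\<Oplus>j\<in>J. f x j \<oplus> (\<Oplus>i\<in>I. f i j))"
    using c' by (intro finsum_addf[symmetric]) (auto intro!: finsum_closed)
  also have "\<dots> = (\<Oplus>j\<in>J. \<Oplus>i\<in>insert x I. f i j)"
  proof (rule finsum_cong'[OF refl])
    show "(\<lambda>j. \<Oplus>i\<in>insert x I. f i j) \<in> J \<rightarrow> carrier E"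
      using insert.prems by (intro funcsetI finsum_closed) auto
    show "f x j \<oplus> (\<Oplus>i\<in>I. f i j) = (\<Oplus>i\<in>insert x I. f i j)" if "j \<in> J" for j
      using insert.hyps c'[OF that] by (intro finsum_insert[symmetric]) auto
  qed
  finally show ?case .
qed

lemma V_nth: "Y \<in> V \<Longrightarrow> Y $ i \<in> carrier E"
  by (simp add: V_def)

lemma VM_nth: "A \<in> VM \<Longrightarrow> A $ i $ j \<in> carrier E"
  by (simp add: VM_def)

lemma V_closed [simp]:
  "vz \<in> V" "iv v \<in> V" "im C \<in> VM" "Y \<in> V \<Longrightarrow> dv Y \<in> V" "Y \<in> V \<Longrightarrow> Z \<in> V \<Longrightarrow> va Y Z \<in> V"
  "A \<in> VM \<Longrightarrow> Y \<in> V \<Longrightarrow> mv A Y \<in> V" "A \<in> VM \<Longrightarrow> B \<in> VM \<Longrightarrow> mm A B \<in> VM"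
  "A \<in> VM \<Longrightarrow> map_matrix \<delta> A \<in> VM" "A \<in> VM \<Longrightarrow> column j A \<in> V"
  by (auto simp: V_def VM_def vz_def iv_def dv_def va_def mv_def mm_def column_def \<delta>_closed
      intro!: finsum_closed)

lemma mv_mm:
  assumes "A \<in> VM" "B \<in> VM" "Y \<in> V"
  shows "mv (mm A B) Y = mv A (mv B Y)"
proof -
  note c = VM_nth[OF assms(1)] VM_nth[OF assms(2)] V_nth[OF assms(3)]
  have "(\<Oplus>k\<in>UNIV. (\<Oplus>m\<in>UNIV. A $ i $ m \<otimes> B $ m $ k) \<otimes> Y $ k)
      = (\<Oplus>m\<in>UNIV. A $ i $ m \<otimes> (\<Oplus>k\<in>UNIV. B $ m $ k \<otimes> Y $ k))" for i
  proof -
    have "(\<Oplus>k\<in>UNIV. (\<Oplus>m\<in>UNIV. A $ i $ m \<otimes> B $ m $ k) \<otimes> Y $ k)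
        = (\<Oplus>k\<in>UNIV. \<Oplus>m\<in>UNIV. A $ i $ m \<otimes> B $ m $ k \<otimes> Y $ k)"
      using c by (intro finsum_cong'[OF refl] finsum_ldistr funcsetI finsum_closed) auto
    also have "\<dots> = (\<Oplus>m\<in>UNIV. \<Oplus>k\<in>UNIV. A $ i $ m \<otimes> B $ m $ k \<otimes> Y $ k)"
      using c by (intro finsum_swap) auto
    also have "\<dots> = (\<Oplus>m\<in>UNIV. \<Oplus>k\<in>UNIV. A $ i $ m \<otimes> (B $ m $ k \<otimes> Y $ k))"
      using c by (simp add: m_assoc)
    also have "\<dots> = (\<Oplus>m\<in>UNIV. A $ i $ m \<otimes> (\<Oplus>k\<in>UNIV. B $ m $ k \<otimes> Y $ k))"
      using c by (intro finsum_cong'[OF refl] finsum_rdistr[symmetric] funcsetI m_closed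
        finsum_closed) auto
    finally show ?thesis .
  qed
  then show ?thesis by (simp add: mv_def mm_def)
qed

lemma mm_column: "column j (mm A B) = mv A (column j B)"
  by (simp add: mm_def mv_def column_def)

lemma im_mult: "im (A ** B) = mm (im A) (im B)"
  by (simp add: vec_eq_iff mm_def matrix_matrix_mult_def \<iota>_sum \<iota>_mult)

lemma iv_mult: "iv (A *v v) = mv (im A) (iv v)"
  by (simp add: vec_eq_iff mv_def iv_def matrix_vector_mult_def \<iota>_sum \<iota>_mult)

lemma mv_im_mult: "Y \<in> V \<Longrightarrow> mv (im (A ** B)) Y = mv (im A) (mv (im B) Y)"
  by (simp add: im_mult mv_mm)

lemma mv_im_add:
  assumes "Y \<in> V"
  shows "mv (im (A + B)) Y = va (mv (im A) Y) (mv (im B) Y)"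
  using V_nth[OF assms]
  by (simp add: vec_eq_iff mv_def va_def \<iota>_add l_distr finsum_addf Pi_def)

lemma mv_im_0: "Y \<in> V \<Longrightarrow> mv (im 0) Y = vz"
  by (simp add: vec_eq_iff mv_def vz_def \<iota>_0 V_nth finsum_zero)

lemma mv_im_sum:
  assumes "finite I" "Y \<in> V"
  shows "mv (im (sum A I)) Y = (\<chi> i. \<Oplus>j\<in>I. mv (im (A j)) Y $ i)"
  using assms(1)
proof (induction I rule: finite_induct)
  case empty
  then show ?case using assms(2) by (simp add: mv_im_0) (simp add: vz_def)
next
  case (insert x I)
  have "mv (im (A j)) Y $ i \<in> carrier E" for i j using assms(2) by (simp add: V_nth)
  then have "(\<Oplus>j\<in>insert x I. mv (im (A j)) Y $ i)
    = mv (im (A x)) Y $ i \<oplus> (\<Oplus>j\<in>I. mv (im (A j)) Y $ i)" for i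
    using insert.hyps by (intro finsum_insert) auto
  then show ?case
    using insert assms(2) by (simp add: mv_im_add va_def vec_eq_iff)
qed

lemma mv_unit:
  assumes "Y \<in> V" "\<And>i k. A $ i $ k = (if i = k then c else \<zero>)" "c \<in> carrier E"
  shows "mv A Y = (\<chi> i. c \<otimes> Y $ i)"
proof -
  have "(\<Oplus>k\<in>UNIV. A $ i $ k \<otimes> Y $ k) = c \<otimes> Y $ i" for i
  proof -
    have "(\<Oplus>k\<in>UNIV. A $ i $ k \<otimes> Y $ k) = (\<Oplus>k\<in>UNIV. if i = k then c \<otimes> Y $ k else \<zero>)"
      using assms by (intro finsum_cong'[OF refl]) (auto simp: V_nth)
    also have "\<dots> = c \<otimes> Y $ i"
      using assms by (intro finsum_singleton) (auto simp: V_nth)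
    finally show ?thesis .
  qed
  then show ?thesis by (simp add: mv_def)
qed

lemma mv_mat: "Y \<in> V \<Longrightarrow> mv (im (mat c)) Y = (\<chi> i. \<iota> c \<otimes> Y $ i)"
  by (rule mv_unit) (auto simp: mat_def \<iota>_0)

lemma mv_1: "Y \<in> V \<Longrightarrow> mv (im (mat 1)) Y = Y"
  by (simp add: mv_mat \<iota>_1 V_nth vec_eq_iff)

lemma mv_vz: "A \<in> VM \<Longrightarrow> mv A vz = vz"
  by (simp add: mv_def vz_def VM_nth finsum_zero)

lemma dv_mv:
  assumes "A \<in> VM" "Y \<in> V"
  shows "dv (mv A Y) = va (mv (map_matrix \<delta> A) Y) (mv A (dv Y))"
proof -
  note c = VM_nth[OF assms(1)] V_nth[OF assms(2)] \<delta>_closed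
  have "\<delta> (\<Oplus>k\<in>UNIV. A $ i $ k \<otimes> Y $ k) =
      (\<Oplus>k\<in>UNIV. \<delta> (A $ i $ k) \<otimes> Y $ k) \<oplus> (\<Oplus>k\<in>UNIV. A $ i $ k \<otimes> \<delta> (Y $ k))" for i
    using c by (simp add: \<delta>_finsum \<delta>_mult finsum_addf Pi_def)
  then show ?thesis by (simp add: dv_def mv_def va_def vec_eq_iff)
qed

lemma map_\<delta>_im: "map_matrix \<delta> (im A) = im (map_matrix d A)"
  by (simp add: vec_eq_iff \<delta>_\<iota>)

lemma dv_mv_im:
  assumes "Y \<in> V" "dv Y = mv (im N) Y"
  shows "dv (mv (im A) Y) = mv (im (map_matrix d A + A ** N)) Y"
  using assms by (simp add: dv_mv map_\<delta>_im mv_im_add mv_im_mult)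

lemma dv_iv: "(\<And>i. d (v $ i) = 0) \<Longrightarrow> dv (iv v) = vz"
  by (simp add: vec_eq_iff dv_def iv_def vz_def \<delta>_\<iota> \<iota>_0)

lemma iv_eq_vz: "iv v = vz \<longleftrightarrow> v = 0"
  by (simp add: vec_eq_iff iv_def vz_def \<iota>_eq_0)

lemma iv_0: "iv 0 = vz"
  by (simp add: iv_eq_vz)

lemma va_cancel: "Y \<in> V \<Longrightarrow> Z \<in> V \<Longrightarrow> W \<in> V \<Longrightarrow> va Y Z = va Y W \<longleftrightarrow> Z = W"
  unfolding va_def vec_eq_iff vec_lambda_beta using add.l_cancel V_nth by metis

lemma va_vz: "Y \<in> V \<Longrightarrow> va Y vz = Y" "Y \<in> V \<Longrightarrow> va vz Y = Y"
  by (simp_all add: va_def vz_def vec_eq_iff V_nth)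

text \<open>The inverse exists already over K and is mapped into E, so no determinants over E are
  needed.\<close>

lemma mv_injective:
  fixes A :: "'a ^ 'n::finite ^ 'n"
  assumes "det A \<noteq> 0" "Y \<in> V" "mv (im A) Y = vz"
  shows "Y = vz"
proof -
  obtain B where "B ** A = mat 1"
    using assms(1) invertible_det_nz invertible_left_inverse by blast
  then have "Y = mv (im B) (mv (im A) Y)"
    using mv_im_mult[OF assms(2), of B A] mv_1[OF assms(2)] by simp
  then show ?thesis using assms(3) by (simp add: mv_vz)
qed

subsection \<open>Operators acting on solutions\<close>

lemma odo_apply_mv:
  assumes "Y \<in> V"
  shows "odo_apply E \<delta> \<iota> P Y
    = (\<chi> i. \<Oplus>j\<in>{..Polynomial.degree P}. mv (im (poly.coeff P j)) ((dv ^^ j) Y) $ i)"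
proof -
  have "(dv ^^ j) Y $ k = (\<delta> ^^ j) (Y $ k)" for j k
    by (induction j) (simp_all add: dv_def)
  then show ?thesis by (simp add: odo_apply_def mv_def)
qed

text \<open>On solutions of DY = N Y each further differentiation turns p_j(N) Y into (p_j(N)' +
  p_j(N) N) Y; this is the origin of the recursion for \<open>p_seq\<close>.\<close>

lemma dv_pow:
  assumes "Y \<in> V" "dv Y = mv (im N) Y"
  shows "(dv ^^ j) Y = mv (im (p_seq d N j)) Y"
proof (induction j)
  case (Suc j)
  then show ?case using dv_mv_im[OF assms, of "p_seq d N j"] by (simp add: add.commute)
qed (simp add: mv_1 assms)

lemma odo_apply_solution:
  assumes "Y \<in> V" "dv Y = mv (im N) Y"
  shows "odo_apply E \<delta> \<iota> P Y = mv (im (\<Sum>j\<le>Polynomial.degree P. poly.coeff P j ** p_seq d N j)) Y"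
  by (simp add: odo_apply_mv dv_pow assms mv_im_sum mv_im_mult)

text \<open>Since A1 is invertible, the eigenvalue equation of L can be solved for DY.\<close>

lemma eigen_L_iff:
  fixes A0 A1 :: "'a ^ 'l::finite ^ 'l"
  assumes A1: "invertible A1" and Y: "Y \<in> V"
  shows "odo_apply E \<delta> \<iota> [:A0, A1:] Y = (\<chi> i. \<iota> l \<otimes> Y $ i) \<longleftrightarrow>
    dv Y = mv (im (N_at [:A0, A1:] l)) Y"
proof -
  let ?N = "N_at [:A0, A1:] l"
  note nz = invertible_nonzero[OF A1]
  have split: "(\<Oplus>j\<in>{..Suc 0}. g j) = g 0 \<oplus> g (Suc 0)" if "\<And>j. g j \<in> carrier E" for g
  proof -
    have "{..Suc 0} = insert 0 {Suc 0}" by auto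
    then have "(\<Oplus>j\<in>{..Suc 0}. g j) = g 0 \<oplus> (\<Oplus>j\<in>{Suc 0}. g j)"
      using that by (simp only:) (intro finsum_insert; auto)
    also have "(\<Oplus>j\<in>{Suc 0}. g j) = g (Suc 0) \<oplus> (\<Oplus>j\<in>{}. g j)"
      using that by (intro finsum_insert) auto
    finally show ?thesis using that by simp
  qed
  have dY: "(dv ^^ j) Y \<in> V" for j using Y by (induction j) auto
  have "odo_apply E \<delta> \<iota> [:A0, A1:] Y = va (mv (im A0) Y) (mv (im A1) (dv Y))"
  proof -
    have "Polynomial.degree [:A0, A1:] = Suc 0" using nz by simp
    moreover have "mv (im A) ((dv ^^ j) Y) $ i \<in> carrier E" for A :: "'a ^ 'l ^ 'l" and j i
      using dY by (simp add: V_nth)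
    then have "(\<Oplus>j\<in>{..Suc 0}. mv (im (poly.coeff [:A0, A1:] j)) ((dv ^^ j) Y) $ i)
        = mv (im A0) Y $ i \<oplus> mv (im A1) (dv Y) $ i" for i
      by (subst split) simp_all
    ultimately show ?thesis
      unfolding odo_apply_mv[OF Y] va_def by (simp only:)
  qed
  moreover have "(\<chi> i. \<iota> l \<otimes> Y $ i) = va (mv (im A0) Y) (mv (im A1) (mv (im ?N) Y))"
    using mv_mat[OF Y, of l] N_at_eq[OF A1, of A0 l] Y
    by (metis mv_im_add mv_im_mult)
  moreover have "mv (im A1) (dv Y) = mv (im A1) (mv (im ?N) Y) \<longleftrightarrow> dv Y = mv (im ?N) Y"
  proof
    assume "mv (im A1) (dv Y) = mv (im A1) (mv (im ?N) Y)"
    then have "mv (im (matrix_inv A1)) (mv (im A1) (dv Y))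
        = mv (im (matrix_inv A1)) (mv (im A1) (mv (im ?N) Y))" by simp
    moreover have "mv (im (matrix_inv A1)) (mv (im A1) Z) = Z" if "Z \<in> V" for Z
      using mv_im_mult[OF that, of "matrix_inv A1" A1] matrix_inv_left[OF A1] mv_1[OF that] by simp
    ultimately show "dv Y = mv (im ?N) Y" using Y by simp
  qed simp
  ultimately show ?thesis using Y by (simp add: va_cancel)
qed

text \<open>On solutions of DY = N Y the operator B acts as the matrix M + m.\<close>

lemma eigen_B_iff:
  fixes L B :: "('a, 'l::finite) odo"
  assumes Y: "Y \<in> V" and N: "dv Y = mv (im (N_at L l)) Y"
  shows "odo_apply E \<delta> \<iota> B Y = (\<chi> i. \<iota> m \<otimes> Y $ i) \<longleftrightarrow> mv (im (M_at L B l m)) Y = vz"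
proof -
  have "odo_apply E \<delta> \<iota> B Y = mv (im (mat m + M_at L B l m)) Y"
    unfolding odo_apply_solution[OF Y N] M_at_expand[of B L l m] by (simp add: add.commute)
  also have "\<dots> = va (\<chi> i. \<iota> m \<otimes> Y $ i) (mv (im (M_at L B l m)) Y)"
    using Y by (simp add: mv_im_add mv_mat)
  finally have eq: "odo_apply E \<delta> \<iota> B Y = va (\<chi> i. \<iota> m \<otimes> Y $ i) (mv (im (M_at L B l m)) Y)" .
  have mY: "(\<chi> i. \<iota> m \<otimes> Y $ i) \<in> V" using Y by (simp add: V_def)
  show ?thesis
    unfolding eq using va_cancel[OF mY, of "mv (im (M_at L B l m)) Y" vz] Y mY by (simp add: va_vz)
qed

lemma common_solution_iff:
  fixes A0 A1 :: "'a ^ 'l::finite ^ 'l"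
  assumes "invertible A1"
  shows "nontrivial_common_solution E \<delta> \<iota> [:A0, A1:] B l m Y \<longleftrightarrow>
    Y \<in> V \<and> Y \<noteq> vz \<and> dv Y = mv (im (N_at [:A0, A1:] l)) Y \<and> mv (im (M_at [:A0, A1:] B l m)) Y = vz"
proof -
  have "(\<exists>i. Y $ i \<noteq> \<zero>) \<longleftrightarrow> Y \<noteq> vz" by (simp add: vz_def vec_eq_iff)
  then show ?thesis
    unfolding nontrivial_common_solution_def
    using eigen_L_iff[OF assms] eigen_B_iff[of Y "[:A0, A1:]" l] by (auto simp: V_def)
qed

section \<open>Common solutions and the vanishing of the determinant\<close>

lemma common_solution_imp_det:
  fixes A0 A1 :: "'a ^ 'l::finite ^ 'l"
  assumes "invertible A1" "nontrivial_common_solution E \<delta> \<iota> [:A0, A1:] B l m Y"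
  shows "det (M_at [:A0, A1:] B l m) = 0"
  using assms mv_injective common_solution_iff by blast

text \<open>M preserves the solution space, so M F = F T with T over C. A constant kernel vector v
  of the singular matrix T gives the common solution F v.\<close>

lemma det_imp_common_solution:
  fixes A0 A1 :: "'a ^ 'l::finite ^ 'l"
  assumes A1: "invertible A1" and comm: "odo_mult d [:A0, A1:] B = odo_mult d B [:A0, A1:]"
    and l: "d l = 0" and m: "d m = 0" and det: "det (M_at [:A0, A1:] B l m) = 0"
    and F: "fundamental_matrix E \<delta> \<iota> (N_at [:A0, A1:] l) F"
    and const: "{x \<in> carrier E. \<delta> x = \<zero>} = \<iota> ` constants d"
  shows "\<exists>\<psi>. nontrivial_common_solution E \<delta> \<iota> [:A0, A1:] B l m \<psi>"
proof -
  define N where "N = N_at [:A0, A1:] l"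
  define M where "M = M_at [:A0, A1:] B l m"
  obtain G where FV: "F \<in> VM" and GV: "G \<in> VM"
    and FG: "\<And>i j. mm F G $ i $ j = (if i = j then \<one> else \<zero>)"
    and GF: "\<And>i j. mm G F $ i $ j = (if i = j then \<one> else \<zero>)"
    and \<delta>F: "map_matrix \<delta> F = mm (im N) F"
    using F unfolding fundamental_matrix_def
    by (auto simp: VM_def mm_def N_def vec_eq_iff)
  have inv: "mv F (mv G Y) = Y" "mv G (mv F Y) = Y" if "Y \<in> V" for Y
    using mv_unit[OF that FG] mv_unit[OF that GF] that FV GV
    by (simp_all add: mv_mm vec_eq_iff V_nth)
  have dF: "dv (mv F Y) = va (mv (im N) (mv F Y)) (mv F (dv Y))" if "Y \<in> V" for Y
    using that FV by (simp add: dv_mv \<delta>F mv_mm)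
  \<comment> \<open>For a solution Z the vector G Z has derivative 0, so its entries are constants
    of E, which all come from C.\<close>
  have span: "\<exists>v. (\<forall>k. v $ k \<in> constants d) \<and> Z = mv F (iv v)"
    if Z: "Z \<in> V" and dZ: "dv Z = mv (im N) Z" for Z
  proof -
    define c where "c = mv G Z"
    have c: "c \<in> V" and Zc: "Z = mv F c" using Z GV inv by (simp_all add: c_def)
    have "va (mv (im N) Z) (mv F (dv c)) = va (mv (im N) Z) vz"
      using dF[OF c] dZ Z by (simp add: Zc[symmetric] va_vz)
    then have "mv F (dv c) = vz" using va_cancel[of "mv (im N) Z" "mv F (dv c)" vz] Z c FV by simp
    then have "dv c = vz" using inv(2)[of "dv c"] c GV by (simp add: mv_vz)
    then have "c $ k \<in> \<iota> ` constants d" for k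
      using c by (auto simp: const[symmetric] dv_def vz_def vec_eq_iff V_nth)
    then have "\<forall>k. \<exists>a. a \<in> constants d \<and> c $ k = \<iota> a" by blast
    then obtain a where a: "\<And>k. a k \<in> constants d" "\<And>k. c $ k = \<iota> (a k)" by metis
    then have "c = iv (\<chi> k. a k)" by (simp add: iv_def vec_eq_iff)
    then show ?thesis using a Zc by (intro exI[of _ "\<chi> k. a k"]) auto
  qed
  have Mder: "map_matrix d M + M ** N = N ** M"
    using M_at_deriv[OF A1 comm l m] by (simp add: M_def N_def)
  \<comment> \<open>The image of a solution Y under M is a solution: (M Y)' = (M' + M N) Y = N M
    Y.\<close>
  have "\<exists>v. (\<forall>k. v $ k \<in> constants d) \<and> mv (im M) (column j F) = mv F (iv v)" for j
  proof (rule span)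
    have cF: "column j F \<in> V" using FV by simp
    then show "mv (im M) (column j F) \<in> V" by simp
    have "dv (column j F) = mv (im N) (column j F)"
      using arg_cong[OF \<delta>F, of "column j"] mm_column[of j "im N" F]
      by (simp add: column_def dv_def vec_eq_iff)
    from dv_mv_im[OF cF this, of M]
    show "dv (mv (im M) (column j F)) = mv (im N) (mv (im M) (column j F))"
      using cF by (simp add: Mder mv_im_mult)
  qed
  then obtain t where t: "\<And>j k. t j $ k \<in> constants d"
    "\<And>j. mv (im M) (column j F) = mv F (iv (t j))" by metis
  define T where "T = (\<chi> k j. t j $ k)"
  have "column j (mm (im M) F) = column j (mm F (im T))" for j
  proof -
    have "column j (im T) = iv (t j)" by (simp add: column_def iv_def T_def vec_eq_iff)
    then show ?thesis by (simp add: mm_column t)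
  qed
  then have MF: "mm (im M) F = mm F (im T)"
    by (simp add: vec_eq_iff column_def)
  have conj: "mv (im M) (mv F Y) = mv F (mv (im T) Y)" if "Y \<in> V" for Y
    using that FV MF by (metis mv_mm V_closed(3))
  \<comment> \<open>T is conjugate to M over E. Singularity is carried over by kernel vectors: if M
    w = 0, then T annihilates G w.\<close>
  have "det T = 0"
  proof (rule ccontr)
    assume T: "det T \<noteq> 0"
    obtain w where w: "w \<noteq> 0" "M *v w = 0" using singular_kernel det M_def by blast
    define c where "c = mv G (iv w)"
    have c: "c \<in> V" "mv F c = iv w" using GV inv by (simp_all add: c_def)
    have "mv F (mv (im T) c) = iv 0"
      using conj[OF c(1)] c(2) w(2) iv_mult[of M w] by simp
    then have "mv F (mv (im T) c) = vz" by (simp add: iv_0)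
    then have "mv (im T) c = vz" using inv(2)[of "mv (im T) c"] c GV by (simp add: mv_vz)
    then have "c = vz" using mv_injective[OF T c(1)] by simp
    then show False using c(2) w(1) FV by (simp add: mv_vz iv_eq_vz[symmetric])
  qed
  \<comment> \<open>F v solves the system exactly when v is constant, so the kernel vector has to be
    taken over C.\<close>
  then obtain v where v: "v \<noteq> 0" "T *v v = 0" "\<And>i. v $ i \<in> constants d"
    using constant_kernel[of T] t(1) by (auto simp: T_def)
  define \<psi> where "\<psi> = mv F (iv v)"
  have \<psi>: "\<psi> \<in> V" using FV by (simp add: \<psi>_def)
  have "\<psi> \<noteq> vz"
    using inv(2)[of "iv v"] v(1) GV iv_eq_vz[of v] by (auto simp: \<psi>_def mv_vz)
  moreover have "dv \<psi> = mv (im N) \<psi>"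
  proof -
    have "dv (iv v) = vz" using v(3) by (intro dv_iv) (simp add: constants_def)
    then show ?thesis using dF[of "iv v"] FV \<psi> by (simp add: \<psi>_def mv_vz va_vz)
  qed
  moreover have "mv (im M) \<psi> = vz"
  proof -
    have "mv (im T) (iv v) = vz" using v(2) iv_mult[of T v] iv_0 by metis
    then show ?thesis using conj[of "iv v"] FV by (simp add: \<psi>_def mv_vz)
  qed
  ultimately show ?thesis
    using common_solution_iff[OF A1, of A0 B l m \<psi>] \<psi> by (auto simp: N_def M_def)
qed

end

(* Extensions whose existence is claimed have their carrier inside the type 'a of the base field:
   this is no restriction, since they are finitely generated over the infinite base field. The
   claims about all extensions are made for every type 'b. *)
theorem corollary2:
  fixes d :: "'a::field_char_0 \<Rightarrow> 'a"
    and A0 A1 :: "'a ^ 'l::finite ^ 'l"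
    and Bs :: "nat \<Rightarrow> 'a ^ 'l ^ 'l"
    and n :: nat
    and L B :: "('a, 'l) odo"
    and l0 m0 :: 'a
    and f :: "'a poly poly"
  assumes "field_derivation d"
    and "constants_alg_closed d"
    and "L = [:A0, A1:]"
    and "invertible A1"
    and "n \<ge> 1"
    and "B = (\<Sum>j\<le>n. monom (Bs j) j)"
    and "odo_mult d L B = odo_mult d B L"
    and "f = DRes d L B"
    and "l0 \<in> constants d"
    and "m0 \<in> constants d"
  shows "(\<forall>i j. coeff (coeff f i) j \<in> constants d) \<and>
    ((\<exists>(E :: 'a ring) \<delta> \<iota> Y. diff_field_extension d E \<delta> \<iota> \<and>
        nontrivial_common_solution E \<delta> \<iota> L B l0 m0 Y)
      \<longleftrightarrow> eval2 f l0 m0 = 0) \<and>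
    (\<forall>(E :: 'b ring) \<delta> \<iota> Y. diff_field_extension d E \<delta> \<iota> \<longrightarrow>
        nontrivial_common_solution E \<delta> \<iota> L B l0 m0 Y \<longrightarrow> eval2 f l0 m0 = 0) \<and>
    (eval2 f l0 m0 = 0 \<longleftrightarrow> (l0, m0) \<in> spectral_curve d L B) \<and>
    (eval2 f l0 m0 = 0 \<longrightarrow>
      (\<exists>(E :: 'a ring) \<delta> \<iota> \<psi>. picard_vessiot d (N_at L l0) E \<delta> \<iota> \<and>
        nontrivial_common_solution E \<delta> \<iota> L B l0 m0 \<psi>) \<and>
      (\<forall>(E :: 'b ring) \<delta> \<iota>. picard_vessiot d (N_at L l0) E \<delta> \<iota> \<longrightarrow>
        (\<exists>\<psi>. nontrivial_common_solution E \<delta> \<iota> L B l0 m0 \<psi>)))"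
proof -
  interpret field_derivation d by fact
  interpret D0: field_derivation_0 d ..
  note comm = assms(7)[unfolded assms(3)]
  have l0: "d l0 = 0" and m0: "d m0 = 0" using assms(9,10) by (simp_all add: constants_def)
  have det: "eval2 f l0 m0 = det (M_at [:A0, A1:] B l0 m0)"
    unfolding assms(8,3) by (rule eval2_DRes[OF l0 m0])
  have const: "\<forall>i j. coeff (coeff f i) j \<in> constants d"
    using DRes_coeff_constant[OF assms(4) comm] assms(3,8) by simp
  have nec: "eval2 f l0 m0 = 0"
    if "diff_field_extension d E \<delta> \<iota>" "nontrivial_common_solution E \<delta> \<iota> L B l0 m0 Y"
    for E :: "'b ring" and \<delta> \<iota> Y
    using diff_field_extension.common_solution_imp_det[OF that(1) assms(4)] that(2) assms(3) det
    by simp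
  have nec': "eval2 f l0 m0 = 0"
    if "diff_field_extension d E \<delta> \<iota>" "nontrivial_common_solution E \<delta> \<iota> L B l0 m0 Y"
    for E :: "'a ring" and \<delta> \<iota> Y
    using diff_field_extension.common_solution_imp_det[OF that(1) assms(4)] that(2) assms(3) det
    by simp
  have suf: "\<exists>\<psi>. nontrivial_common_solution E \<delta> \<iota> L B l0 m0 \<psi>"
    if "eval2 f l0 m0 = 0" "picard_vessiot d (N_at L l0) E \<delta> \<iota>"
    for E :: "'b ring" and \<delta> \<iota>
    using that diff_field_extension.det_imp_common_solution[OF _ assms(4) comm l0 m0, of E \<delta> \<iota>]
      assms(3) det unfolding picard_vessiot_def by auto
  have suf': "\<exists>\<psi>. nontrivial_common_solution E \<delta> \<iota> L B l0 m0 \<psi>"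
    if "eval2 f l0 m0 = 0" "picard_vessiot d (N_at L l0) E \<delta> \<iota>"
    for E :: "'a ring" and \<delta> \<iota>
    using that diff_field_extension.det_imp_common_solution[OF _ assms(4) comm l0 m0, of E \<delta> \<iota>]
      assms(3) det unfolding picard_vessiot_def by auto
  \<comment> \<open>This extension exists whether or not the point lies on the curve; on the curve
    it supplies the witness for both existence claims.\<close>
  obtain E :: "'a ring" and \<delta> \<iota> where PV: "picard_vessiot d (N_at L l0) E \<delta> \<iota>"
    using D0.picard_vessiot_ex[OF assms(2), of "N_at L l0"] by blast
  then have ext: "diff_field_extension d E \<delta> \<iota>" by (simp add: picard_vessiot_def)
  have curve: "eval2 f l0 m0 = 0 \<longleftrightarrow> (l0, m0) \<in> spectral_curve d L B"
    using assms(8-10) by (simp add: spectral_curve_def)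
  show ?thesis
  proof (intro conjI allI impI)
    show "coeff (coeff f i) j \<in> constants d" for i j using const by blast
    show "(\<exists>(E :: 'a ring) \<delta> \<iota> Y. diff_field_extension d E \<delta> \<iota> \<and>
        nontrivial_common_solution E \<delta> \<iota> L B l0 m0 Y) \<longleftrightarrow> eval2 f l0 m0 = 0"
      using nec' suf'[OF _ PV] ext by blast
    show "\<exists>(E :: 'a ring) \<delta> \<iota> \<psi>. picard_vessiot d (N_at L l0) E \<delta> \<iota> \<and>
        nontrivial_common_solution E \<delta> \<iota> L B l0 m0 \<psi>" if "eval2 f l0 m0 = 0"
      using suf'[OF that PV] PV by blast
  qed (use nec suf curve in blast)+
qed

end
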